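(* For $\xi\in\mathbb R$ let $g_\xi(x)=e^{2\pi i\xi x}$ and $\mathcal F(g_\xi)=\{e^{2\pi i nx}:n=0,1,2,\dots\}\cup\{e^{2\pi i(\xi+n)x}:n=-1,-2,\dots\}\subset L^2[-1/2,1/2]$. Then: (1) if $\xi<-1/2$, $\mathcal F(g_\xi)$ is not complete; (2) if $-1/2<\xi<1/2$, $\mathcal F(g_\xi)$ is a Riesz basis; (3) if $-1/2+n<\xi<1/2+n$ for some integer $n\ge1$, $\mathcal F(g_\xi)$ is a frame but not a Riesz basis; (4) if $\xi=-1/2+n$ for some integer $n\ge0$, $\mathcal F(g_\xi)$ is complete but is neither a Riesz basis nor a frame.
   Context: Complete: $\langle f,h_k\rangle=0$ for all $k$ implies $f=0$. Frame: $A\|f\|^2\le\sum_k|\langle f,h_k\rangle|^2\le B\|f\|^2$ for some $0<A\le B<\infty$ and all $f\in L^2[-1/2,1/2]$. Riesz basis: a frame such that every $f$ has a unique expansion $f=\sum_k\alpha_kh_k$. *)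

theory Defs
  imports "HOL-Analysis.Analysis"
begin

definition I0 :: "real set" where "I0 = {-1/2 .. 1/2}"

text \<open>Membership in L^2[-1/2,1/2] (functions are representatives; equality is a.e.).\<close>
definition L2 :: "(real \<Rightarrow> complex) set" where
  "L2 = {f. f \<in> borel_measurable (lebesgue_on I0) \<and>
            integrable (lebesgue_on I0) (\<lambda>x. (cmod (f x))\<^sup>2)}"

definition L2_inner :: "(real \<Rightarrow> complex) \<Rightarrow> (real \<Rightarrow> complex) \<Rightarrow> complex" where
  "L2_inner f h = (LINT x | lebesgue_on I0. f x * cnj (h x))"

definition L2_norm :: "(real \<Rightarrow> complex) \<Rightarrow> real" where
  "L2_norm f = sqrt (LINT x | lebesgue_on I0. (cmod (f x))\<^sup>2)"

definition complete_system :: "(int \<Rightarrow> real \<Rightarrow> complex) \<Rightarrow> bool" where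
  "complete_system h \<longleftrightarrow>
     (\<forall>f\<in>L2. (\<forall>k. L2_inner f (h k) = 0) \<longrightarrow> L2_norm f = 0)"

definition is_frame :: "(int \<Rightarrow> real \<Rightarrow> complex) \<Rightarrow> bool" where
  "is_frame h \<longleftrightarrow>
     (\<exists>A B. 0 < A \<and> A \<le> B \<and>
        (\<forall>f\<in>L2. (\<lambda>k. (cmod (L2_inner f (h k)))\<^sup>2) summable_on UNIV \<and>
           A * (L2_norm f)\<^sup>2 \<le> (\<Sum>\<^sub>\<infinity>k. (cmod (L2_inner f (h k)))\<^sup>2) \<and>
           (\<Sum>\<^sub>\<infinity>k. (cmod (L2_inner f (h k)))\<^sup>2) \<le> B * (L2_norm f)\<^sup>2))"

definition has_expansion ::
    "(int \<Rightarrow> real \<Rightarrow> complex) \<Rightarrow> (real \<Rightarrow> complex) \<Rightarrow> (int \<Rightarrow> complex) \<Rightarrow> bool" where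
  "has_expansion h f \<alpha> \<longleftrightarrow>
     ((\<lambda>F. L2_norm (\<lambda>x. f x - (\<Sum>k\<in>F. \<alpha> k * h k x))) \<longlongrightarrow> 0)
       (finite_subsets_at_top UNIV)"

definition riesz_basis :: "(int \<Rightarrow> real \<Rightarrow> complex) \<Rightarrow> bool" where
  "riesz_basis h \<longleftrightarrow> is_frame h \<and> (\<forall>f\<in>L2. \<exists>!\<alpha>. has_expansion h f \<alpha>)"

definition expo :: "real \<Rightarrow> real \<Rightarrow> complex" where
  "expo t x = exp (\<i> * complex_of_real (2 * pi * t * x))"

definition Fsys :: "real \<Rightarrow> int \<Rightarrow> real \<Rightarrow> complex" where
  "Fsys \<xi> k = (if k \<ge> 0 then expo (real_of_int k) else expo (\<xi> + real_of_int k))"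

end

theory Submission
  imports Defs
begin

text \<open>
  Multiplying by the unimodular function \<open>expo (-\<xi>/2)\<close> turns the operator \<open>expo k \<mapsto> Fsys \<xi> k\<close>
  into \<open>p \<mapsto> cos (\<pi>\<xi>x) p - i sin (\<pi>\<xi>x) Hp\<close>, where \<open>H\<close> multiplies the coefficients by the sign
  of the frequency and so preserves the norm. On the interval this differs from the identity by
  at most \<open>1 - cos (\<pi>\<bar>\<xi>\<bar>/2) + sin (\<pi>\<bar>\<xi>\<bar>/2)\<close>, which is below \<open>1\<close> when \<open>\<bar>\<xi>\<bar> < 1/2\<close>; hence the Riesz basis property. Removing the \<open>n\<close> elements with indices
  \<open>-n, \<dots>, -1\<close> from \<open>Fsys \<xi>\<close> leaves \<open>Fsys (\<xi> - n)\<close>, so for larger \<open>\<xi>\<close> completeness and the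
  lower frame bound are inherited, while uniqueness of expansions is lost.

  For \<open>a > -1/2\<close> the square integrable function \<open>cos (\<pi>x) powr a * expo (-1 - a/2) x\<close> is
  orthogonal to \<open>Fsys (-1 - a)\<close>, which settles \<open>\<xi> < -1/2\<close>. Letting \<open>a\<close> tend to \<open>-1/2\<close>, its norm
  tends to infinity while its coefficients with respect to \<open>Fsys (-1/2 + n)\<close> become relatively
  small, so there is no lower frame bound at the critical shifts.
\<close>

section \<open>The space of square integrable functions\<close>

abbreviation MI :: "real measure" where "MI \<equiv> lebesgue_on I0"

lemma I0_lmeasurable: "I0 \<in> lmeasurable"
  unfolding I0_def by simp

lemma finite_measure_MI: "finite_measure MI"
  by (rule finite_measure_lebesgue_on) (rule I0_lmeasurable)

lemma measure_MI: "measure MI (space MI) = 1"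
  unfolding I0_def by (simp add: measure_restrict_space)

lemma continuous_imp_measurable_MI:
  fixes f :: "real \<Rightarrow> 'a::euclidean_space"
  assumes "continuous_on UNIV f"
  shows "f \<in> borel_measurable MI"
  using assms I0_lmeasurable
  by (intro continuous_imp_measurable_on_sets_lebesgue) (auto intro: continuous_on_subset)

lemma L2_measurable: "f \<in> L2 \<Longrightarrow> f \<in> borel_measurable MI"
  by (simp add: L2_def)

lemma L2_square_integrable: "f \<in> L2 \<Longrightarrow> integrable MI (\<lambda>x. (cmod (f x))\<^sup>2)"
  by (simp add: L2_def)

lemma integrable_MI_bounded:
  fixes f :: "real \<Rightarrow> 'a::{banach,second_countable_topology}"
  assumes "f \<in> borel_measurable MI" "\<And>x. x \<in> I0 \<Longrightarrow> norm (f x) \<le> C"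
  shows "integrable MI f"
  using assms by (intro finite_measure.integrable_const_bound[OF finite_measure_MI, of _ C])
    (auto intro!: AE_I2)

lemma L2_bounded:
  assumes [measurable]: "f \<in> borel_measurable MI" and "\<And>x. x \<in> I0 \<Longrightarrow> cmod (f x) \<le> C"
  shows "f \<in> L2"
proof -
  have "integrable MI (\<lambda>x. (cmod (f x))\<^sup>2)"
    using assms(2) by (intro integrable_MI_bounded[where C="C\<^sup>2"]) (auto intro: power_mono)
  then show ?thesis
    using assms(1) by (simp add: L2_def)
qed

lemma L2_continuous:
  assumes "continuous_on UNIV f"
  shows "f \<in> L2"
proof -
  have "compact (f ` I0)"
    using assms unfolding I0_def
    by (intro compact_continuous_image) (auto intro: continuous_on_subset)
  then obtain C where "\<And>x. x \<in> I0 \<Longrightarrow> cmod (f x) \<le> C"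
    using compact_imp_bounded[of "f ` I0"] unfolding bounded_iff by auto
  then show ?thesis
    using assms by (intro L2_bounded[of _ C] continuous_imp_measurable_MI)
qed

lemma L2_add:
  assumes "f \<in> L2" "g \<in> L2"
  shows "(\<lambda>x. f x + g x) \<in> L2"
proof -
  note [measurable] = assms[THEN L2_measurable]
  have "integrable MI (\<lambda>x. (cmod (f x + g x))\<^sup>2)"
  proof (rule Bochner_Integration.integrable_bound)
    show "integrable MI (\<lambda>x. 2 * (cmod (f x))\<^sup>2 + 2 * (cmod (g x))\<^sup>2)"
      using assms[THEN L2_square_integrable] by auto
    have "(cmod (f x + g x))\<^sup>2 \<le> 2 * (cmod (f x))\<^sup>2 + 2 * (cmod (g x))\<^sup>2" for x
    proof -
      have "(cmod (f x + g x))\<^sup>2 \<le> (cmod (f x) + cmod (g x))\<^sup>2"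
        by (intro power_mono norm_triangle_ineq norm_ge_zero)
      also have "\<dots> \<le> 2 * (cmod (f x))\<^sup>2 + 2 * (cmod (g x))\<^sup>2"
        using sum_squares_bound[of "cmod (f x)" "cmod (g x)"] by (simp add: power2_sum)
      finally show ?thesis .
    qed
    then show "AE x in MI. norm ((cmod (f x + g x))\<^sup>2) \<le> norm (2 * (cmod (f x))\<^sup>2 + 2 * (cmod (g x))\<^sup>2)"
      by (intro AE_I2) simp
  qed simp
  then show ?thesis
    by (simp add: L2_def)
qed

lemma L2_mult_bounded:
  assumes "f \<in> L2" and u: "u \<in> borel_measurable MI" "\<And>x. x \<in> I0 \<Longrightarrow> cmod (u x) \<le> C"
  shows "(\<lambda>x. f x * u x) \<in> L2"
proof -
  note [measurable] = assms(1)[THEN L2_measurable] u(1)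
  have "integrable MI (\<lambda>x. (cmod (f x * u x))\<^sup>2)"
  proof (rule Bochner_Integration.integrable_bound)
    show "integrable MI (\<lambda>x. C\<^sup>2 * (cmod (f x))\<^sup>2)"
      using assms(1)[THEN L2_square_integrable] by auto
    have "(cmod (f x * u x))\<^sup>2 \<le> C\<^sup>2 * (cmod (f x))\<^sup>2" if "x \<in> I0" for x
      using u(2)[OF that]
      by (simp add: norm_mult power_mult_distrib mult.commute[of "C\<^sup>2"] mult_left_mono power_mono)
    then show "AE x in MI. norm ((cmod (f x * u x))\<^sup>2) \<le> norm (C\<^sup>2 * (cmod (f x))\<^sup>2)"
      by (intro AE_I2) simp
  qed simp
  then show ?thesis
    by (simp add: L2_def)
qed

lemma L2_scale: "f \<in> L2 \<Longrightarrow> (\<lambda>x. c * f x) \<in> L2"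
  using L2_mult_bounded[of f "\<lambda>_. c" "cmod c"] by (simp add: mult.commute)

lemma L2_diff: "f \<in> L2 \<Longrightarrow> g \<in> L2 \<Longrightarrow> (\<lambda>x. f x - g x) \<in> L2"
  using L2_add[of f "\<lambda>x. (-1) * g x"] L2_scale[of g "-1"] by simp

lemma L2_zero: "(\<lambda>x. 0) \<in> L2"
  by (intro L2_continuous continuous_intros)

lemma L2_sum: "(\<And>k. k \<in> F \<Longrightarrow> h k \<in> L2) \<Longrightarrow> (\<lambda>x. \<Sum>k\<in>F. c k * h k x) \<in> L2"
  by (induction F rule: infinite_finite_induct)
    (auto intro: L2_zero L2_add[OF L2_scale])

section \<open>Inner product, norm and their inequalities\<close>

lemma L2_inner_integrable:
  assumes "f \<in> L2" "g \<in> L2"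
  shows "integrable MI (\<lambda>x. f x * cnj (g x))"
proof (rule Bochner_Integration.integrable_bound)
  note [measurable] = assms[THEN L2_measurable]
  show "(\<lambda>x. f x * cnj (g x)) \<in> borel_measurable MI"
    by (intro borel_measurable_times borel_measurable_continuous_on[of cnj]) (auto intro: continuous_intros)
  show "integrable MI (\<lambda>x. (cmod (f x))\<^sup>2 + (cmod (g x))\<^sup>2)"
    using assms[THEN L2_square_integrable] by auto
  have "cmod (f x) * cmod (g x) \<le> (cmod (f x))\<^sup>2 + (cmod (g x))\<^sup>2" for x
    using sum_squares_bound[of "cmod (f x)" "cmod (g x)"]
      mult_nonneg_nonneg[of "cmod (f x)" "cmod (g x)"] by (simp del: mult_nonneg_nonneg)
  then show "AE x in MI. norm (f x * cnj (g x)) \<le> norm ((cmod (f x))\<^sup>2 + (cmod (g x))\<^sup>2)"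
    by (intro AE_I2) (simp add: norm_mult)
qed

lemma L2_inner_commute: "L2_inner g f = cnj (L2_inner f g)"
proof -
  have "cnj (L2_inner f g) = (LINT x|MI. cnj (f x * cnj (g x)))"
    unfolding L2_inner_def by (rule Bochner_Integration.integral_cnj[symmetric])
  then show ?thesis
    by (simp add: L2_inner_def mult.commute)
qed

lemma L2_inner_add_left:
  "f \<in> L2 \<Longrightarrow> f' \<in> L2 \<Longrightarrow> g \<in> L2 \<Longrightarrow> L2_inner (\<lambda>x. f x + f' x) g = L2_inner f g + L2_inner f' g"
  by (simp add: L2_inner_def distrib_right L2_inner_integrable)

lemma L2_inner_diff_left:
  "f \<in> L2 \<Longrightarrow> f' \<in> L2 \<Longrightarrow> g \<in> L2 \<Longrightarrow> L2_inner (\<lambda>x. f x - f' x) g = L2_inner f g - L2_inner f' g"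
  by (simp add: L2_inner_def left_diff_distrib L2_inner_integrable)

lemma L2_inner_scale_left: "L2_inner (\<lambda>x. c * f x) g = c * L2_inner f g"
  by (simp add: L2_inner_def mult.assoc)

lemma L2_inner_sum_left:
  assumes "\<And>k. k \<in> F \<Longrightarrow> h k \<in> L2" "g \<in> L2"
  shows "L2_inner (\<lambda>x. \<Sum>k\<in>F. c k * h k x) g = (\<Sum>k\<in>F. c k * L2_inner (h k) g)"
  using assms
proof (induction F rule: infinite_finite_induct)
  case (insert k F)
  then show ?case
    by (simp add: L2_inner_add_left L2_scale L2_sum L2_inner_scale_left)
qed (simp_all add: L2_inner_def)

lemma L2_inner_diff_right:
  "f \<in> L2 \<Longrightarrow> f' \<in> L2 \<Longrightarrow> g \<in> L2 \<Longrightarrow> L2_inner g (\<lambda>x. f x - f' x) = L2_inner g f - L2_inner g f'"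
  by (simp add: L2_inner_commute[of g] L2_inner_diff_left)

lemma L2_inner_sum_right:
  assumes "\<And>k. k \<in> F \<Longrightarrow> h k \<in> L2" "g \<in> L2"
  shows "L2_inner g (\<lambda>x. \<Sum>k\<in>F. c k * h k x) = (\<Sum>k\<in>F. cnj (c k) * L2_inner g (h k))"
  by (simp add: L2_inner_commute[of g] L2_inner_sum_left assms cnj_sum)

lemma L2_norm_nonneg: "0 \<le> L2_norm f"
  by (simp add: L2_norm_def)

lemma L2_norm_square: "(L2_norm f)\<^sup>2 = (LINT x|MI. (cmod (f x))\<^sup>2)"
  by (simp add: L2_norm_def)

lemma L2_inner_self: "L2_inner f f = of_real ((L2_norm f)\<^sup>2)"
proof -
  have "L2_inner f f = (LINT x|MI. complex_of_real ((cmod (f x))\<^sup>2))"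
    unfolding L2_inner_def by (intro Bochner_Integration.integral_cong refl) (metis complex_norm_square)
  then show ?thesis
    by (simp only: integral_complex_of_real L2_norm_square)
qed

lemma L2_norm_scale: "L2_norm (\<lambda>x. c * f x) = cmod c * L2_norm f"
  by (simp add: L2_norm_def norm_mult power_mult_distrib real_sqrt_mult)

lemma L2_norm_minus_commute: "L2_norm (\<lambda>x. f x - g x) = L2_norm (\<lambda>x. g x - f x)"
  by (simp add: L2_norm_def norm_minus_commute)

lemma L2_norm_mono:
  assumes "f \<in> L2" "g \<in> L2" "C \<ge> 0" "\<And>x. x \<in> I0 \<Longrightarrow> cmod (f x) \<le> C * cmod (g x)"
  shows "L2_norm f \<le> C * L2_norm g"
proof -
  have "(L2_norm f)\<^sup>2 \<le> (LINT x|MI. C\<^sup>2 * (cmod (g x))\<^sup>2)"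
    unfolding L2_norm_square using assms
    by (intro integral_mono integrable_mult_right L2_square_integrable)
      (auto simp flip: power_mult_distrib intro: power_mono)
  also have "\<dots> = (C * L2_norm g)\<^sup>2"
    by (simp add: L2_norm_square power_mult_distrib)
  finally show ?thesis
    using assms(3) by (intro power2_le_imp_le[OF _ mult_nonneg_nonneg]) (auto simp: L2_norm_nonneg)
qed

lemma L2_norm_diff_square:
  assumes "f \<in> L2" "g \<in> L2"
  shows "(L2_norm (\<lambda>x. f x - g x))\<^sup>2 = (L2_norm f)\<^sup>2 - 2 * Re (L2_inner f g) + (L2_norm g)\<^sup>2"
proof -
  have "complex_of_real ((L2_norm (\<lambda>x. f x - g x))\<^sup>2)
      = L2_inner f f - L2_inner f g - (L2_inner g f - L2_inner g g)"
    using assms by (simp add: L2_inner_self[symmetric] L2_inner_diff_left L2_inner_diff_right L2_diff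
        del: of_real_power)
  then have "Re (complex_of_real ((L2_norm (\<lambda>x. f x - g x))\<^sup>2))
      = Re (L2_inner f f - L2_inner f g - (cnj (L2_inner f g) - L2_inner g g))"
    using L2_inner_commute[of g f] by simp
  then show ?thesis
    by (simp add: L2_inner_self)
qed

text \<open>Expand the squared norm of \<open>s f - t u g\<close>, where the phase \<open>u\<close>
  makes the inner product real, and choose \<open>s\<close> and \<open>t\<close>. Functions are
  representatives, so a vanishing norm does not make a function zero; that case is settled by
  letting one parameter grow.\<close>

lemma L2_Cauchy_Schwarz:
  assumes "f \<in> L2" "g \<in> L2"
  shows "cmod (L2_inner f g) \<le> L2_norm f * L2_norm g"
proof -
  define z where "z = L2_inner f g"
  define u where "u = (if z = 0 then 1 else z / of_real (cmod z))"
  have u: "cmod u = 1" "cnj u * z = of_real (cmod z)"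
    using complex_norm_square[of z]
    by (auto simp: u_def norm_divide power2_eq_square mult.commute field_simps)
  have key: "2 * s * t * cmod z \<le> s\<^sup>2 * (L2_norm f)\<^sup>2 + t\<^sup>2 * (L2_norm g)\<^sup>2" for s t :: real
  proof -
    let ?f = "\<lambda>x. of_real s * f x" and ?g = "\<lambda>x. (of_real t * u) * g x"
    have "L2_inner ?f ?g = of_real s * cnj (of_real t * u) * z"
      by (subst L2_inner_commute, simp only: L2_inner_scale_left, subst L2_inner_commute)
        (simp only: L2_inner_scale_left z_def complex_cnj_mult complex_cnj_cnj mult_ac)
    also have "\<dots> = of_real (s * t * cmod z)"
      using u(2) by (simp add: mult_ac)
    finally have "Re (L2_inner ?f ?g) = s * t * cmod z"
      by simp
    moreover have "0 \<le> (L2_norm ?f)\<^sup>2 - 2 * Re (L2_inner ?f ?g) + (L2_norm ?g)\<^sup>2"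
      using assms by (subst L2_norm_diff_square[symmetric]) (auto intro: L2_scale)
    ultimately show ?thesis
      using u(1) by (simp add: L2_norm_scale norm_mult power_mult_distrib algebra_simps)
  qed
  have "cmod z \<le> L2_norm f * L2_norm g"
  proof (cases "L2_norm f * L2_norm g = 0")
    case False
    then have "L2_norm f * L2_norm g > 0"
      using L2_norm_nonneg[of f] L2_norm_nonneg[of g] by (metis less_eq_real_def mult_nonneg_nonneg)
    moreover have "2 * (L2_norm f * L2_norm g) * cmod z \<le> 2 * (L2_norm f * L2_norm g)\<^sup>2"
      using key[of "L2_norm g" "L2_norm f"] by (simp add: power_mult_distrib mult_ac)
    ultimately show ?thesis
      by (intro mult_left_le_imp_le[of "L2_norm f * L2_norm g" "cmod z"]) (auto simp: power2_eq_square)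
  next
    case True
    have "cmod z \<le> 0"
    proof (rule field_le_epsilon)
      fix e :: real
      assume "0 < e"
      \<comment> \<open>\<open>K\<close> is positive and dominates both squared norms; scaling the
        function of norm zero by \<open>K/e\<close> leaves \<open>cmod z\<close> at most
        \<open>e/2\<close>.\<close>
      define K where "K = (L2_norm f)\<^sup>2 + (L2_norm g)\<^sup>2 + 1"
      have K: "K > 0"
        by (simp add: K_def add_nonneg_pos)
      show "cmod z \<le> 0 + e"
      proof (cases "L2_norm f = 0")
        case True
        have "2 * (K/e) * cmod z \<le> K"
          using key[of "K/e" 1] True by (simp add: K_def)
        then have "2 * cmod z \<le> e"
          using K \<open>0 < e\<close> by (simp add: field_simps)
        then show ?thesis
          using norm_ge_zero[of z] by linarith
      next
        case False
        have "2 * (K/e) * cmod z \<le> K"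
          using key[of 1 "K/e"] True False by (simp add: K_def)
        then have "2 * cmod z \<le> e"
          using K \<open>0 < e\<close> by (simp add: field_simps)
        then show ?thesis
          using norm_ge_zero[of z] by linarith
      qed
    qed
    then show ?thesis
      unfolding True .
  qed
  then show ?thesis
    by (simp add: z_def)
qed

lemma L2_norm_triangle_diff:
  assumes "f \<in> L2" "g \<in> L2"
  shows "L2_norm (\<lambda>x. f x - g x) \<le> L2_norm f + L2_norm g"
proof (rule power2_le_imp_le)
  have "\<bar>Re (L2_inner f g)\<bar> \<le> L2_norm f * L2_norm g"
    using L2_Cauchy_Schwarz[OF assms] abs_Re_le_cmod order_trans by blast
  then show "(L2_norm (\<lambda>x. f x - g x))\<^sup>2 \<le> (L2_norm f + L2_norm g)\<^sup>2"
    unfolding L2_norm_diff_square[OF assms] power2_sum by linarith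
qed (simp add: L2_norm_nonneg)

lemma L2_norm_triangle:
  assumes "f \<in> L2" "g \<in> L2"
  shows "L2_norm (\<lambda>x. f x + g x) \<le> L2_norm f + L2_norm g"
  using L2_norm_triangle_diff[OF assms(1) L2_scale[OF assms(2), of "-1"]]
  by (simp add: L2_norm_scale[of "-1", simplified])

lemma L2_norm_triangle_via:
  assumes "f \<in> L2" "g \<in> L2" "h \<in> L2"
  shows "L2_norm (\<lambda>x. f x - h x) \<le> L2_norm (\<lambda>x. f x - g x) + L2_norm (\<lambda>x. g x - h x)"
  using L2_norm_triangle[OF L2_diff L2_diff, OF assms(1,2,2,3)] by simp

lemma L2_norm_diff_lower:
  assumes "f \<in> L2" "g \<in> L2"
  shows "L2_norm f - L2_norm (\<lambda>x. f x - g x) \<le> L2_norm g"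
  using L2_norm_triangle[OF L2_diff assms(2), OF assms] by simp

section \<open>Exponentials and trigonometric polynomials\<close>

lemma expo_0: "expo 0 x = 1"
  by (simp add: expo_def)

lemma expo_add: "expo (s + t) x = expo s x * expo t x"
  by (simp add: expo_def exp_add[symmetric] algebra_simps)

lemma cnj_expo: "cnj (expo t x) = expo (-t) x"
  by (simp add: expo_def exp_cnj)

lemma norm_expo [simp]: "cmod (expo t x) = 1"
  by (simp add: expo_def)

lemma expo_cis: "expo t x = cis (2 * pi * t * x)"
  by (simp add: expo_def cis_conv_exp)

lemma continuous_on_expo [continuous_intros]: "continuous_on S (expo t)"
  unfolding expo_def by (intro continuous_intros)

lemma expo_measurable [measurable]: "expo t \<in> borel_measurable MI"
  by (intro continuous_imp_measurable_MI continuous_intros)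

lemma L2_expo [simp]: "expo t \<in> L2"
  by (intro L2_continuous continuous_intros)

lemma L2_mult_expo: "f \<in> L2 \<Longrightarrow> (\<lambda>x. f x * expo t x) \<in> L2"
  by (rule L2_mult_bounded[where C=1]) auto

lemma L2_norm_mult_expo: "L2_norm (\<lambda>x. f x * expo t x) = L2_norm f"
  by (simp add: L2_norm_def norm_mult)

text \<open>Part of the frequency moves onto \<open>f\<close>, so that coefficients at non-integer
  frequencies become Fourier coefficients of a modulated function.\<close>

lemma L2_inner_expo_shift: "L2_inner f (expo (s + t)) = L2_inner (\<lambda>x. f x * expo (-s) x) (expo t)"
  by (simp add: L2_inner_def expo_add cnj_expo mult.assoc)

lemma expo_has_vector_derivative:
  "(expo t has_vector_derivative (2 * pi * t * \<i>) * expo t x) (at x within S)"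
proof -
  have "((\<lambda>z. exp (\<i> * complex_of_real (2 * pi * t) * z)) has_field_derivative
      (2 * pi * t * \<i>) * expo t x) (at (complex_of_real x))"
    unfolding expo_def by (auto intro!: derivative_eq_intros simp: mult_ac)
  from has_vector_derivative_real_field[OF this] show ?thesis
    by (simp add: expo_def[abs_def] mult.assoc)
qed

lemma integral_expo_int:
  assumes "m \<noteq> 0"
  shows "(LINT x|MI. expo (of_int m) x) = 0"
proof -
  define d where "d = complex_of_real (2 * pi * of_int m) * \<i>"
  have d: "d \<noteq> 0"
    using assms by (simp add: d_def)
  have "((\<lambda>x. expo (of_int m) x) has_integral
      expo (of_int m) (1/2) / d - expo (of_int m) (-1/2) / d) {-1/2..1/2}"
  proof (rule fundamental_theorem_of_calculus)
    fix x :: real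
    have "((\<lambda>x. expo (of_int m) x / d) has_vector_derivative d * expo (of_int m) x / d)
        (at x within {-1/2..1/2})"
      unfolding d_def by (intro has_vector_derivative_divide expo_has_vector_derivative)
    then show "((\<lambda>x. expo (of_int m) x / d) has_vector_derivative expo (of_int m) x)
        (at x within {-1/2..1/2})"
      using d by simp
  qed simp
  \<comment> \<open>The endpoints lie a whole number of periods apart.\<close>
  moreover have "expo (of_int m) (1/2) = expo (of_int m) (-1/2)"
  proof -
    have "expo (of_int m) (1/2) = expo (of_int m) (-1/2) * cis (2 * pi * of_int m)"
      unfolding expo_cis cis_mult by (rule arg_cong[where f=cis]) (simp add: field_simps)
    also have "cis (2 * pi * of_int m) = 1"
      by simp
    finally show ?thesis
      by simp
  qed
  ultimately have "integral {-1/2..1/2} (expo (of_int m)) = 0"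
    by (simp add: integral_unique)
  moreover have "integrable MI (expo (of_int m))"
    by (rule integrable_MI_bounded[of _ 1]) auto
  ultimately show ?thesis
    using I0_lmeasurable
    by (subst lebesgue_integral_eq_integral) (auto simp: I0_def)
qed

lemma expo_orthonormal:
  "L2_inner (expo (of_int j)) (expo (of_int k)) = (if j = k then 1 else 0)"
proof -
  have "L2_inner (expo (of_int j)) (expo (of_int k)) = (LINT x|MI. expo (of_int (j - k)) x)"
    by (simp add: L2_inner_def cnj_expo expo_add[symmetric])
  also have "\<dots> = (if j = k then 1 else 0)"
    using integral_expo_int[of "j - k"] measure_MI by (auto simp: expo_0)
  finally show ?thesis .
qed

section \<open>Finite Fourier sums, Bessel's inequality and trigonometric polynomials\<close>

abbreviation trig_sum :: "int set \<Rightarrow> (int \<Rightarrow> complex) \<Rightarrow> real \<Rightarrow> complex" where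
  "trig_sum F c \<equiv> \<lambda>x. \<Sum>k\<in>F. c k * expo (of_int k) x"

abbreviation fourier :: "(real \<Rightarrow> complex) \<Rightarrow> int \<Rightarrow> complex" where
  "fourier f k \<equiv> L2_inner f (expo (of_int k))"

lemma L2_trig_sum [simp]: "trig_sum F c \<in> L2"
  by (rule L2_sum) simp

lemma fourier_trig_sum:
  assumes "finite F"
  shows "fourier (trig_sum F c) k = (if k \<in> F then c k else 0)"
  using assms by (simp add: L2_inner_sum_left expo_orthonormal if_distrib[of "\<lambda>x. _ * x"] cong: if_cong)

lemma L2_norm_trig_sum:
  assumes "finite F"
  shows "(L2_norm (trig_sum F c))\<^sup>2 = (\<Sum>k\<in>F. (cmod (c k))\<^sup>2)"
proof -
  have "complex_of_real ((L2_norm (trig_sum F c))\<^sup>2) = (\<Sum>k\<in>F. cnj (c k) * c k)"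
    using assms unfolding L2_inner_self[symmetric]
    by (subst L2_inner_sum_right) (auto simp: fourier_trig_sum)
  also have "\<dots> = of_real (\<Sum>k\<in>F. (cmod (c k))\<^sup>2)"
    unfolding of_real_sum complex_norm_square by (simp add: mult.commute)
  finally show ?thesis
    using of_real_eq_iff by blast
qed

text \<open>Completing the square confines the dependence on \<open>c\<close> to the last sum. The
  choice \<open>c = fourier f\<close> makes that sum vanish, which yields both Bessel's inequality
  and the best approximation property.\<close>

lemma L2_norm_diff_trig_sum:
  assumes "f \<in> L2" "finite F"
  shows "(L2_norm (\<lambda>x. f x - trig_sum F c x))\<^sup>2
      = (L2_norm f)\<^sup>2 - (\<Sum>k\<in>F. (cmod (fourier f k))\<^sup>2) + (\<Sum>k\<in>F. (cmod (fourier f k - c k))\<^sup>2)"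
proof -
  have *: "(cmod (a - b))\<^sup>2 = (cmod a)\<^sup>2 - 2 * Re (cnj b * a) + (cmod b)\<^sup>2" for a b
    by (simp only: cmod_power2) (simp add: power2_eq_square algebra_simps)
  have "(\<Sum>k\<in>F. (cmod (fourier f k - c k))\<^sup>2)
      = (\<Sum>k\<in>F. (cmod (fourier f k))\<^sup>2) - 2 * Re (\<Sum>k\<in>F. cnj (c k) * fourier f k)
        + (\<Sum>k\<in>F. (cmod (c k))\<^sup>2)"
    unfolding * Re_sum by (simp only: sum.distrib sum_subtractf sum_distrib_left)
  then show ?thesis
    using assms by (simp add: L2_norm_diff_square L2_norm_trig_sum L2_inner_sum_right)
qed

lemma Bessel:
  assumes "f \<in> L2" "finite F"
  shows "(\<Sum>k\<in>F. (cmod (fourier f k))\<^sup>2) \<le> (L2_norm f)\<^sup>2"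
proof -
  have "0 \<le> (L2_norm (\<lambda>x. f x - trig_sum F (fourier f) x))\<^sup>2"
    by simp
  then show ?thesis
    by (simp add: L2_norm_diff_trig_sum[OF assms])
qed

lemma fourier_best_approximation:
  assumes "f \<in> L2" "finite F"
  shows "L2_norm (\<lambda>x. f x - trig_sum F (fourier f) x) \<le> L2_norm (\<lambda>x. f x - trig_sum F c x)"
proof (rule power2_le_imp_le)
  show "(L2_norm (\<lambda>x. f x - trig_sum F (fourier f) x))\<^sup>2 \<le> (L2_norm (\<lambda>x. f x - trig_sum F c x))\<^sup>2"
    unfolding L2_norm_diff_trig_sum[OF assms] by (simp add: sum_nonneg)
qed (rule L2_norm_nonneg)

text \<open>The inductive form gives closure under sums and products by induction, without
  collecting equal frequencies; \<open>trig_poly_imp_trig_sum\<close> collects them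
  afterwards.\<close>

inductive trig_poly :: "(real \<Rightarrow> complex) \<Rightarrow> bool" where
  trig_poly_zero: "trig_poly (\<lambda>x. 0)"
| trig_poly_step: "trig_poly p \<Longrightarrow> trig_poly (\<lambda>x. c * expo (of_int k) x + p x)"

lemma trig_poly_expo: "trig_poly (\<lambda>x. c * expo (of_int k) x)"
  using trig_poly_step[OF trig_poly_zero] by simp

lemma trig_poly_const: "trig_poly (\<lambda>x. c)"
  using trig_poly_expo[of c 0] by (simp add: expo_0)

lemma trig_poly_add: "trig_poly p \<Longrightarrow> trig_poly q \<Longrightarrow> trig_poly (\<lambda>x. p x + q x)"
  by (induction rule: trig_poly.induct) (auto simp: add.assoc intro: trig_poly_step)

lemma trig_poly_mult_expo: "trig_poly p \<Longrightarrow> trig_poly (\<lambda>x. c * expo (of_int k) x * p x)"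
proof (induction rule: trig_poly.induct)
  case (trig_poly_step p d j)
  have "trig_poly (\<lambda>x. (c * d) * expo (of_int (k + j)) x + c * expo (of_int k) x * p x)"
    by (rule trig_poly.trig_poly_step) (rule trig_poly_step.IH)
  then show ?case
    by (simp add: expo_add algebra_simps)
qed (simp add: trig_poly_zero)

lemma trig_poly_mult: "trig_poly p \<Longrightarrow> trig_poly q \<Longrightarrow> trig_poly (\<lambda>x. p x * q x)"
  by (induction rule: trig_poly.induct)
    (auto simp: distrib_right intro: trig_poly_zero trig_poly_add trig_poly_mult_expo)

lemma trig_poly_imp_trig_sum:
  "trig_poly p \<Longrightarrow> \<exists>F c. finite F \<and> p = trig_sum F c"
proof (induction rule: trig_poly.induct)
  case trig_poly_zero
  show ?case
    by (rule exI[of _ "{}"]) simp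
next
  case (trig_poly_step p a k)
  then obtain F c where F: "finite F" "p = trig_sum F c"
    by blast
  \<comment> \<open>\<open>k\<close> may already occur in \<open>F\<close>; its two coefficients are
    then added.\<close>
  define c' where "c' j = (if j \<in> F then c j else 0) + (if j = k then a else 0)" for j
  have "trig_sum (insert k F) c' x = a * expo (of_int k) x + p x" for x
  proof -
    have "trig_sum (insert k F) c' x = (\<Sum>j\<in>insert k F. (if j \<in> F then c j * expo (of_int j) x else 0))
        + (\<Sum>j\<in>insert k F. (if j = k then a * expo (of_int j) x else 0))"
      unfolding c'_def sum.distrib[symmetric] by (intro sum.cong refl) (auto simp: distrib_right)
    also have "(\<Sum>j\<in>insert k F. (if j \<in> F then c j * expo (of_int j) x else 0)) = p x"
      unfolding F(2) using F(1) by (intro sum.mono_neutral_cong_right) auto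
    also have "(\<Sum>j\<in>insert k F. (if j = k then a * expo (of_int j) x else 0)) = a * expo (of_int k) x"
      using F(1) by (subst sum.delta) auto
    finally show ?thesis
      by (simp add: add.commute)
  qed
  then show ?case
    using F(1) by (intro exI[of _ "insert k F"] exI[of _ c']) auto
qed

lemma trig_poly_L2: "trig_poly p \<Longrightarrow> p \<in> L2"
  using trig_poly_imp_trig_sum L2_trig_sum by blast

section \<open>Density of the trigonometric polynomials\<close>

text \<open>Stone-Weierstrass will deliver polynomials in the real coordinates of the plane. On the
  unit circle conjugation is inversion, so a real linear functional becomes a combination of the
  frequencies 1 and -1.\<close>

lemma trig_poly_real_polynomial:
  fixes f :: "complex \<Rightarrow> real"
  shows "real_polynomial_function f \<Longrightarrow> trig_poly (\<lambda>x. of_real (f (expo 1 x)))"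
proof (induction rule: real_polynomial_function.induct)
  case (linear f)
  interpret bounded_linear f
    by fact
  obtain a b where ab: "a = f 1" "b = f \<i>"
    by blast
  have "f z = Re z * a + Im z * b" for z
  proof -
    have "f z = f (Re z *\<^sub>R 1 + Im z *\<^sub>R \<i>)"
      by (rule arg_cong[where f=f]) (simp add: complex_eq_iff)
    then show ?thesis
      by (simp add: add scaleR ab)
  qed
  then have "complex_of_real (f z) = (a / 2 - \<i> * (b / 2)) * z + (a / 2 + \<i> * (b / 2)) * cnj z" for z
    by (simp add: complex_eq_iff)
  then have "(\<lambda>x. complex_of_real (f (expo 1 x))) = (\<lambda>x. (a / 2 - \<i> * (b / 2)) * expo (of_int 1) x
      + (a / 2 + \<i> * (b / 2)) * expo (of_int (-1)) x)"
    by (simp add: cnj_expo)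
  then show ?case
    by (simp only: trig_poly_add trig_poly_expo)
qed (simp_all add: trig_poly_const trig_poly_add trig_poly_mult)

lemma trig_poly_polynomial:
  fixes g :: "complex \<Rightarrow> complex"
  assumes "polynomial_function g"
  shows "trig_poly (\<lambda>x. g (expo 1 x))"
proof -
  have "trig_poly (\<lambda>x. of_real (Re (g (expo 1 x))))" "trig_poly (\<lambda>x. of_real (Im (g (expo 1 x))))"
    using assms bounded_linear_Re bounded_linear_Im unfolding polynomial_function_def
    by (auto intro!: trig_poly_real_polynomial simp: o_def)
  then have "trig_poly (\<lambda>x. of_real (Re (g (expo 1 x))) + \<i> * of_real (Im (g (expo 1 x))))"
    by (intro trig_poly_add trig_poly_mult trig_poly_const)
  then show ?thesis
    by (simp add: complex_eq[symmetric])
qed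

text \<open>The aim is that this is all of \<open>L2\<close>. It is reached in four stages:
  continuous functions damped to zero at the endpoints, continuous functions, bounded measurable
  functions, arbitrary elements.\<close>

definition trig_closure :: "(real \<Rightarrow> complex) set" where
  "trig_closure = {f \<in> L2. \<forall>e>0. \<exists>p. trig_poly p \<and> L2_norm (\<lambda>x. f x - p x) < e}"

lemma trig_closure_limit:
  assumes f: "f \<in> L2" and g: "\<And>n. g n \<in> trig_closure"
    and lim: "(\<lambda>n. L2_norm (\<lambda>x. f x - g n x)) \<longlonglongrightarrow> 0"
  shows "f \<in> trig_closure"
  unfolding trig_closure_def
proof (intro CollectI conjI allI impI f)
  fix e :: real
  assume "e > 0"
  then obtain n where n: "L2_norm (\<lambda>x. f x - g n x) < e / 2"
    using order_tendstoD(2)[OF lim, of "e/2"] by (auto simp: eventually_sequentially)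
  obtain p where p: "trig_poly p" "L2_norm (\<lambda>x. g n x - p x) < e / 2"
    using g[of n] \<open>e > 0\<close> unfolding trig_closure_def by (auto dest: spec[of _ "e/2"])
  have "L2_norm (\<lambda>x. f x - p x) < e"
    using L2_norm_triangle_via[OF f _ trig_poly_L2[OF p(1)], of "g n"] g[of n] n p(2)
    by (simp add: trig_closure_def)
  then show "\<exists>p. trig_poly p \<and> L2_norm (\<lambda>x. f x - p x) < e"
    using p(1) by blast
qed

text \<open>Dominated convergence for the squared error turns almost everywhere convergence into
  norm convergence.\<close>

lemma trig_closure_dominated:
  assumes f: "f \<in> L2" and g: "\<And>n. g n \<in> trig_closure"
    and w: "integrable MI w" "\<And>n x. x \<in> I0 \<Longrightarrow> (cmod (f x - g n x))\<^sup>2 \<le> w x"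
    and lim: "AE x in MI. (\<lambda>n. g n x) \<longlonglongrightarrow> f x"
  shows "f \<in> trig_closure"
proof (rule trig_closure_limit[OF f g])
  have [measurable]: "f \<in> borel_measurable MI" "\<And>n. g n \<in> borel_measurable MI"
    using f g L2_measurable by (auto simp: trig_closure_def)
  have "(\<lambda>n. LINT x|MI. (cmod (f x - g n x))\<^sup>2) \<longlonglongrightarrow> (LINT x|MI. 0)"
  proof (rule integral_dominated_convergence[where w=w])
    show "AE x in MI. (\<lambda>n. (cmod (f x - g n x))\<^sup>2) \<longlonglongrightarrow> 0"
      using lim
    proof eventually_elim
      case (elim x)
      have "(\<lambda>n. (cmod (f x - g n x))\<^sup>2) \<longlonglongrightarrow> (cmod (f x - f x))\<^sup>2"
        by (intro tendsto_intros elim)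
      then show ?case
        by simp
    qed
    show "AE x in MI. norm ((cmod (f x - g n x))\<^sup>2) \<le> w x" for n
      using w(2) by (intro AE_I2) simp
  qed (use w(1) in auto)
  then have "(\<lambda>n. sqrt (LINT x|MI. (cmod (f x - g n x))\<^sup>2)) \<longlonglongrightarrow> sqrt 0"
    by (intro tendsto_real_sqrt) simp
  then show "(\<lambda>n. L2_norm (\<lambda>x. f x - g n x)) \<longlonglongrightarrow> 0"
    by (simp add: L2_norm_def)
qed

lemma L2_norm_uniform_bound:
  assumes "f \<in> L2" "C \<ge> 0" "\<And>x. x \<in> I0 \<Longrightarrow> cmod (f x) \<le> C"
  shows "L2_norm f \<le> C"
proof -
  have "L2_norm (\<lambda>x. 1) = 1"
    using measure_MI by (simp add: L2_norm_def)
  moreover have "(\<lambda>x. 1) \<in> L2"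
    by (intro L2_continuous continuous_intros)
  ultimately show ?thesis
    using L2_norm_mono[of f "\<lambda>x. 1" C] assms by simp
qed

lemma expo_1_minus_half: "expo 1 (-1/2) = -1"
  by (simp add: expo_cis complex_eq_iff)

lemma Arg_expo: "-1/2 < x \<Longrightarrow> x \<le> 1/2 \<Longrightarrow> Arg (expo 1 x) = 2 * pi * x"
  using mult_strict_left_mono[of "-1/2" x "2 * pi"] mult_left_mono[of x "1/2" "2 * pi"]
  unfolding expo_cis by (intro cis_Arg_unique) (auto simp: sgn_div_norm)

text \<open>The factor vanishes at both endpoints, so the product descends to a continuous function
  on the circle even if \<open>g\<close> takes different values there. Stone-Weierstrass applies to
  that function.\<close>

lemma continuous_cutoff_trig_closure:
  fixes g :: "real \<Rightarrow> complex" and m :: real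
  assumes g: "continuous_on UNIV g" and m: "m \<ge> 0"
  shows "(\<lambda>x. g x * of_real (min 1 (m * (1 + cos (2 * pi * x))))) \<in> trig_closure" (is "?f \<in> _")
proof -
  have "compact (g ` I0)"
    using g unfolding I0_def by (intro compact_continuous_image) (auto intro: continuous_on_subset)
  then obtain C where C: "\<And>x. x \<in> I0 \<Longrightarrow> cmod (g x) \<le> C"
    using compact_imp_bounded[of "g ` I0"] unfolding bounded_iff by auto
  \<comment> \<open>At \<open>z = expo 1 x\<close> the quantity \<open>1 + Re z\<close> is
    \<open>1 + cos (2 * pi * x)\<close>, and \<open>Arg\<close> recovers \<open>x\<close>.\<close>
  define G where "G z = g (Arg z / (2 * pi)) * of_real (min 1 (m * (1 + Re z)))" for z
  have Arg_I0: "Arg z / (2 * pi) \<in> I0" for z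
    using Arg_bounded[of z] by (auto simp: I0_def field_simps)
  have "continuous (at z within sphere 0 1) G" if z: "z \<in> sphere 0 1" for z
  proof (cases "z = -1")
    case False
    then have "z \<notin> \<real>\<^sub>\<le>\<^sub>0"
      using z by (auto simp: complex_nonpos_Reals_iff cmod_def complex_eq_iff power2_eq_1_iff)
    then have "isCont (\<lambda>z. g (Arg z / (2 * pi))) z"
      using g by (intro continuous_at_compose[of z _ g, unfolded o_def] continuous_intros continuous_at_Arg)
        (auto simp: continuous_on_eq_continuous_at)
    then have "isCont G z"
      unfolding G_def by (intro continuous_intros linear_continuous_at[OF bounded_linear_Re])
    then show ?thesis
      by (rule continuous_at_imp_continuous_within)
  next
    case True
    have "((\<lambda>w. C * (m * (1 + Re w))) \<longlongrightarrow> C * (m * (1 + Re z))) (at z within sphere 0 1)"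
      by (intro tendsto_intros)
    then have *: "((\<lambda>w. C * (m * (1 + Re w))) \<longlongrightarrow> 0) (at z within sphere 0 1)"
      by (simp add: True)
    \<comment> \<open>\<open>Arg\<close> jumps at -1, but the cutoff tends to zero there and
      \<open>g\<close> is bounded on \<open>I0\<close>, so \<open>G\<close> is squeezed to
      0.\<close>
    have "(G \<longlongrightarrow> 0) (at z within sphere 0 1)"
    proof (rule Lim_null_comparison[OF _ *])
      have "cmod (G w) \<le> C * (m * (1 + Re w))" if "w \<in> sphere 0 1" for w
      proof -
        have "1 + Re w \<ge> 0"
          using that abs_Re_le_cmod[of w] by simp
        then have "0 \<le> m * (1 + Re w)"
          using m by simp
        moreover have "0 \<le> C"
          using C[OF Arg_I0[of w]] norm_ge_zero order_trans by blast
        ultimately show ?thesis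
          unfolding G_def norm_mult using C[OF Arg_I0[of w]] by (intro mult_mono) auto
      qed
      then show "eventually (\<lambda>w. cmod (G w) \<le> C * (m * (1 + Re w))) (at z within sphere 0 1)"
        by (auto simp: eventually_at_filter)
    qed
    then show ?thesis
      by (simp add: continuous_within True G_def)
  qed
  then have contG: "continuous_on (sphere 0 1) G"
    by (simp add: continuous_on_eq_continuous_within)
  have fG: "?f x = G (expo 1 x)" if "x \<in> I0" for x
  proof (cases "x = -1/2")
    \<comment> \<open>\<open>Arg\<close> sends the point -1 to the right endpoint, so the left one
      is checked apart: the cutoff makes both sides 0.\<close>
    case True
    then show ?thesis
      using expo_1_minus_half by (simp add: G_def)
  next
    case False
    then have "Arg (expo 1 x) = 2 * pi * x"
      using that by (intro Arg_expo) (auto simp: I0_def)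
    then show ?thesis
      by (simp add: G_def expo_cis)
  qed
  have fL2: "?f \<in> L2"
    by (intro L2_continuous continuous_intros g)
  show ?thesis
    unfolding trig_closure_def
  proof (intro CollectI conjI allI impI fL2)
    fix e :: real
    assume "e > 0"
    then obtain P where P: "polynomial_function P" "\<And>z. z \<in> sphere 0 1 \<Longrightarrow> cmod (G z - P z) < e / 2"
      using Stone_Weierstrass_polynomial_function[OF compact_sphere contG, of "e/2"] by auto
    let ?p = "\<lambda>x. P (expo 1 x)"
    have p: "trig_poly ?p"
      using P(1) by (rule trig_poly_polynomial)
    have "L2_norm (\<lambda>x. ?f x - ?p x) \<le> e / 2"
      using \<open>e > 0\<close> P(2) fG
      by (intro L2_norm_uniform_bound L2_diff fL2 trig_poly_L2 p) (auto intro: less_imp_le)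
    then have "L2_norm (\<lambda>x. ?f x - ?p x) < e"
      using \<open>e > 0\<close> by simp
    then show "\<exists>p. trig_poly p \<and> L2_norm (\<lambda>x. ?f x - p x) < e"
      using p by blast
  qed
qed

lemma AE_MI_interior: "AE x in MI. -1/2 < x \<and> x < 1/2"
proof -
  have "{-1/2, 1/2::real} \<in> null_sets lebesgue"
    using countable_imp_null_set_lborel[of "{-1/2, 1/2::real}"] by (simp add: null_sets_completionI)
  then have "AE x in lebesgue. x \<notin> {-1/2, 1/2::real}"
    by (rule AE_not_in)
  then have "AE x in lebesgue. x \<in> I0 \<longrightarrow> -1/2 < x \<and> x < 1/2"
    by eventually_elim (auto simp: I0_def)
  then show ?thesis
    using I0_lmeasurable by (subst AE_restrict_space_iff) auto
qed

text \<open>As \<open>n\<close> grows, the cutoff with slope \<open>n\<close> is eventually 1 at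
  each interior point, and the error never exceeds \<open>cmod (g x)\<close>.\<close>

lemma continuous_trig_closure:
  assumes g: "continuous_on UNIV g"
  shows "g \<in> trig_closure"
proof (rule trig_closure_dominated[where g="\<lambda>n x. g x * of_real (min 1 (real n * (1 + cos (2 * pi * x))))"
      and w="\<lambda>x. (cmod (g x))\<^sup>2"])
  show gL2: "g \<in> L2"
    using g by (rule L2_continuous)
  then show "integrable MI (\<lambda>x. (cmod (g x))\<^sup>2)"
    by (rule L2_square_integrable)
  show "(\<lambda>x. g x * of_real (min 1 (real n * (1 + cos (2 * pi * x))))) \<in> trig_closure" for n
    by (rule continuous_cutoff_trig_closure[OF g]) simp
  show "(cmod (g x - g x * of_real (min 1 (real n * (1 + cos (2 * pi * x))))))\<^sup>2 \<le> (cmod (g x))\<^sup>2" for n x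
  proof -
    define t where "t = min 1 (real n * (1 + cos (2 * pi * x)))"
    have "1 + cos (2 * pi * x) \<ge> 0"
      using cos_ge_minus_one[of "2 * pi * x"] by linarith
    then have t: "0 \<le> t" "t \<le> 1"
      by (auto simp: t_def)
    have "cmod (g x - g x * of_real t) = cmod (g x * of_real (1 - t))"
      by (simp add: algebra_simps)
    also have "\<dots> \<le> cmod (g x)"
      unfolding norm_mult using t by (intro mult_left_le) (auto simp del: of_real_diff)
    finally show ?thesis
      unfolding t_def by (intro power_mono) auto
  qed
  show "AE x in MI. (\<lambda>n. g x * of_real (min 1 (real n * (1 + cos (2 * pi * x))))) \<longlonglongrightarrow> g x"
    using AE_MI_interior
  proof eventually_elim
    case (elim x)
    have "cos pi < cos \<bar>2 * pi * x\<bar>"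
      using elim by (intro cos_monotone_0_pi) (auto simp: abs_mult)
    then have pos: "0 < 1 + cos (2 * pi * x)"
      by simp
    obtain N :: nat where N: "1 / (1 + cos (2 * pi * x)) \<le> real N"
      using real_arch_simple by blast
    have "1 \<le> real n * (1 + cos (2 * pi * x))" if "n \<ge> N" for n
    proof -
      have "1 \<le> real N * (1 + cos (2 * pi * x))"
        using N pos by (simp add: pos_divide_le_eq)
      also have "\<dots> \<le> real n * (1 + cos (2 * pi * x))"
        using that pos by (intro mult_right_mono) auto
      finally show ?thesis .
    qed
    then have "eventually (\<lambda>n. g x * of_real (min 1 (real n * (1 + cos (2 * pi * x)))) = g x) sequentially"
      unfolding eventually_sequentially by (intro exI[of _ N]) (auto simp: min_absorb1)
    then show ?case
      by (rule tendsto_eventually)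
  qed
qed

text \<open>For positive \<open>C\<close> this is the radial truncation to the disc of radius
  \<open>C\<close>: continuous, preserving directions, and the identity on the disc.\<close>

definition clip :: "real \<Rightarrow> complex \<Rightarrow> complex" where
  "clip C z = z / of_real (max 1 (cmod z / C))"

lemma clip_eq: "C > 0 \<Longrightarrow> cmod z \<le> C \<Longrightarrow> clip C z = z"
  by (simp add: clip_def max_def)

lemma cmod_clip: "cmod (clip C z) = cmod z / max 1 (cmod z / C)"
  by (simp add: clip_def norm_divide)

lemma cmod_clip_le_bound: "C > 0 \<Longrightarrow> cmod (clip C z) \<le> C"
  unfolding cmod_clip by (subst pos_divide_le_eq) (auto simp: max_def field_simps)

lemma cmod_clip_le_cmod: "cmod (clip C z) \<le> cmod z"
  unfolding cmod_clip using mult_left_mono[of 1 "max 1 (cmod z / C)" "cmod z"]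
  by (subst pos_divide_le_eq) auto

lemma continuous_on_clip: "continuous_on S f \<Longrightarrow> continuous_on S (\<lambda>x. clip C (f x))"
proof -
  assume "continuous_on S f"
  moreover have "max 1 y \<noteq> 0" for y :: real
    by (simp add: max_def)
  ultimately show ?thesis
    unfolding clip_def divide_inverse[of _ C] by (intro continuous_intros) auto
qed

text \<open>A measurable function is almost everywhere a limit of continuous ones. Clipping these at
  \<open>C\<close> keeps them continuous, preserves the limit because \<open>f x\<close> lies in the
  disc, and supplies a dominating constant.\<close>

lemma bounded_trig_closure:
  assumes f: "f \<in> borel_measurable MI" and C: "C > 0" "\<And>x. x \<in> I0 \<Longrightarrow> cmod (f x) \<le> C"
  shows "f \<in> trig_closure"
proof -
  have I0: "I0 \<in> sets lebesgue"
    using I0_lmeasurable by auto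
  have "(\<lambda>x. if x \<in> I0 then f x else 0) \<in> borel_measurable lebesgue"
    using f I0 by (simp add: borel_measurable_if)
  then have "(\<lambda>x. if x \<in> I0 then f x else 0) measurable_on I0"
    using I0 by (rule lebesgue_measurable_imp_measurable_on)
  then obtain N g where N: "negligible N" and g: "\<And>n. continuous_on UNIV (g n)"
    and lim: "\<And>x. x \<notin> N \<Longrightarrow> (\<lambda>n. g n x) \<longlonglongrightarrow> (if x \<in> I0 then if x \<in> I0 then f x else 0 else 0)"
    unfolding measurable_on_def by blast
  have fL2: "f \<in> L2"
    using f C by (intro L2_bounded)
  show ?thesis
  proof (rule trig_closure_dominated[where g="\<lambda>n x. clip C (g n x)" and w="\<lambda>x. (2 * C)\<^sup>2"])
    show "f \<in> L2"
      by fact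
    show "(\<lambda>x. clip C (g n x)) \<in> trig_closure" for n
      using g by (intro continuous_trig_closure continuous_on_clip)
    show "integrable MI (\<lambda>x. (2 * C)\<^sup>2)"
      by (rule integrable_MI_bounded[of _ "(2 * C)\<^sup>2"]) auto
    show "(cmod (f x - clip C (g n x)))\<^sup>2 \<le> (2 * C)\<^sup>2" if "x \<in> I0" for n x
      using norm_triangle_ineq4[of "f x" "clip C (g n x)"] C(2)[OF that] cmod_clip_le_bound[OF C(1), of "g n x"]
      by (intro power_mono) auto
    have "AE x in lebesgue. x \<notin> N"
      using N by (intro AE_not_in) (simp add: negligible_iff_null_sets)
    then have "AE x in lebesgue. x \<in> I0 \<longrightarrow> (\<lambda>n. clip C (g n x)) \<longlonglongrightarrow> f x"
    proof eventually_elim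
      case (elim x)
      show ?case
      proof
        assume x: "x \<in> I0"
        have "isCont (clip C) (f x)"
          using continuous_on_clip[of UNIV "\<lambda>z. z" C] by (simp add: continuous_on_eq_continuous_at)
        moreover have "(\<lambda>n. g n x) \<longlonglongrightarrow> f x"
          using lim[OF elim] x by simp
        ultimately have "(\<lambda>n. clip C (g n x)) \<longlonglongrightarrow> clip C (f x)"
          by (rule isCont_tendsto_compose)
        then show "(\<lambda>n. clip C (g n x)) \<longlonglongrightarrow> f x"
          using C(2)[OF x] by (simp add: clip_eq C(1))
      qed
    qed
    then show "AE x in MI. (\<lambda>n. clip C (g n x)) \<longlonglongrightarrow> f x"
      using I0 by (subst AE_restrict_space_iff) auto
  qed
qed

text \<open>Truncation at height \<open>Suc n\<close> changes a given value for only finitely many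
  \<open>n\<close>. The error is at most \<open>2 * cmod (f x)\<close>, whence the factor 4 in the
  dominating function.\<close>

lemma L2_trig_closure:
  assumes f: "f \<in> L2"
  shows "f \<in> trig_closure"
proof (rule trig_closure_dominated[where g="\<lambda>n x. clip (real (Suc n)) (f x)" and w="\<lambda>x. 4 * (cmod (f x))\<^sup>2"])
  have "clip C \<in> borel_measurable borel" for C
    using continuous_on_clip[of UNIV "\<lambda>z. z" C] by (intro borel_measurable_continuous_onI) simp
  then have "(\<lambda>x. clip C (f x)) \<in> borel_measurable MI" for C
    using L2_measurable[OF f] by (rule measurable_compose[rotated])
  then show "(\<lambda>x. clip (real (Suc n)) (f x)) \<in> trig_closure" for n
    by (rule bounded_trig_closure[of _ "real (Suc n)"]) (auto intro!: cmod_clip_le_bound simp del: of_nat_Suc)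
  show "integrable MI (\<lambda>x. 4 * (cmod (f x))\<^sup>2)"
    using L2_square_integrable[OF f] by simp
  show "(cmod (f x - clip (real (Suc n)) (f x)))\<^sup>2 \<le> 4 * (cmod (f x))\<^sup>2" for n x
  proof -
    have "cmod (f x - clip (real (Suc n)) (f x)) \<le> 2 * cmod (f x)"
      using norm_triangle_ineq4[of "f x" "clip (real (Suc n)) (f x)"] cmod_clip_le_cmod[of "real (Suc n)" "f x"]
      by linarith
    then have "(cmod (f x - clip (real (Suc n)) (f x)))\<^sup>2 \<le> (2 * cmod (f x))\<^sup>2"
      by (intro power_mono) auto
    then show ?thesis
      by (simp add: power_mult_distrib)
  qed
  have "(\<lambda>n. clip (real (Suc n)) (f x)) \<longlonglongrightarrow> f x" for x
  proof -
    obtain N :: nat where N: "cmod (f x) \<le> real N"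
      using real_arch_simple by blast
    have "clip (real (Suc n)) (f x) = f x" if "n \<ge> N" for n
      using that N by (intro clip_eq) auto
    then show ?thesis
      by (intro tendsto_eventually) (auto simp: eventually_sequentially)
  qed
  then show "AE x in MI. (\<lambda>n. clip (real (Suc n)) (f x)) \<longlonglongrightarrow> f x"
    by simp
qed (rule f)

text \<open>Density in the form used later: by best approximation, the unknown coefficients of an
  approximating polynomial may be replaced by the Fourier coefficients of \<open>f\<close>.\<close>

lemma fourier_approximation:
  assumes f: "f \<in> L2" and e: "e > 0"
  shows "\<exists>F. finite F \<and> L2_norm (\<lambda>x. f x - trig_sum F (fourier f) x) < e"
proof -
  obtain p where p: "trig_poly p" "L2_norm (\<lambda>x. f x - p x) < e"
    using L2_trig_closure[OF f] e by (auto simp: trig_closure_def)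
  then obtain F c where F: "finite F" "p = trig_sum F c"
    using trig_poly_imp_trig_sum by blast
  then have "L2_norm (\<lambda>x. f x - trig_sum F (fourier f) x) < e"
    using fourier_best_approximation[OF f F(1), of c] p(2) by simp
  then show ?thesis
    using F(1) by blast
qed

section \<open>Riesz systems\<close>

abbreviation lincomb :: "(int \<Rightarrow> real \<Rightarrow> complex) \<Rightarrow> int set \<Rightarrow> (int \<Rightarrow> complex) \<Rightarrow> real \<Rightarrow> complex" where
  "lincomb h F b \<equiv> \<lambda>x. \<Sum>k\<in>F. b k * h k x"

lemma lincomb_extend:
  assumes "finite G" "F \<subseteq> G" "\<And>k. k \<notin> F \<Longrightarrow> b k = 0"
  shows "lincomb h F b x = lincomb h G b x"
  using assms by (intro sum.mono_neutral_left) auto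

lemma has_expansion_iff:
  "has_expansion h f \<alpha> \<longleftrightarrow> (\<forall>e>0. \<exists>F. finite F \<and>
     (\<forall>G. finite G \<longrightarrow> F \<subseteq> G \<longrightarrow> L2_norm (\<lambda>x. f x - lincomb h G \<alpha> x) < e))"
  unfolding has_expansion_def tendsto_iff eventually_finite_subsets_at_top
  by (simp add: dist_real_def L2_norm_nonneg) (meson)

text \<open>Comparability of finite combinations with the l2 norm of their coefficients, together
  with density, is the input from which unique unconditional expansions are derived.\<close>

locale riesz_system =
  fixes h :: "int \<Rightarrow> real \<Rightarrow> complex" and a c :: real
  assumes h: "h k \<in> L2" and a: "0 < a" and c: "0 \<le> c"
    and lower: "finite F \<Longrightarrow> a * L2_set (\<lambda>k. cmod (b k)) F \<le> L2_norm (lincomb h F b)"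
    and upper: "finite F \<Longrightarrow> L2_norm (lincomb h F b) \<le> c * L2_set (\<lambda>k. cmod (b k)) F"
    and dense: "f \<in> L2 \<Longrightarrow> 0 < e \<Longrightarrow> \<exists>F b. finite F \<and> L2_norm (\<lambda>x. f x - lincomb h F b x) < e"
begin

lemma lincomb_L2: "lincomb h F b \<in> L2"
  by (intro L2_sum h)

lemma coefficient_le: "finite F \<Longrightarrow> k \<in> F \<Longrightarrow> a * cmod (b k) \<le> L2_norm (lincomb h F b)"
  using lower[of F b] member_le_L2_set[of F k "\<lambda>k. cmod (b k)"] a
    mult_left_mono[of "cmod (b k)" "L2_set (\<lambda>k. cmod (b k)) F" a] by (meson less_imp_le order_trans)

lemma expansion_unique:
  assumes f: "f \<in> L2" and "has_expansion h f \<alpha>" "has_expansion h f \<beta>"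
  shows "\<alpha> = \<beta>"
proof
  fix k
  have "a * cmod (\<alpha> k - \<beta> k) \<le> 0 + e" if "e > 0" for e
  proof -
    have e: "e / 2 > 0"
      using that by simp
    from assms(2)[unfolded has_expansion_iff, rule_format, OF e]
    obtain F where F: "finite F"
      and 1: "\<And>G. finite G \<Longrightarrow> F \<subseteq> G \<Longrightarrow> L2_norm (\<lambda>x. f x - lincomb h G \<alpha> x) < e / 2"
      by blast
    from assms(3)[unfolded has_expansion_iff, rule_format, OF e]
    obtain F' where F': "finite F'"
      and 2: "\<And>G. finite G \<Longrightarrow> F' \<subseteq> G \<Longrightarrow> L2_norm (\<lambda>x. f x - lincomb h G \<beta> x) < e / 2"
      by blast
    \<comment> \<open>A common finite set beyond both thresholds and containing \<open>k\<close>: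
      there both expansions are close to \<open>f\<close>, and the lower bound controls the
      \<open>k\<close>-th difference.\<close>
    let ?G = "insert k (F \<union> F')"
    have "a * cmod (\<alpha> k - \<beta> k) \<le> L2_norm (lincomb h ?G (\<lambda>k. \<alpha> k - \<beta> k))"
      using F F' by (intro coefficient_le) auto
    also have "lincomb h ?G (\<lambda>k. \<alpha> k - \<beta> k) = (\<lambda>x. lincomb h ?G \<alpha> x - lincomb h ?G \<beta> x)"
      by (simp only: left_diff_distrib sum_subtractf)
    also have "L2_norm \<dots> \<le> L2_norm (\<lambda>x. lincomb h ?G \<alpha> x - f x) + L2_norm (\<lambda>x. f x - lincomb h ?G \<beta> x)"
      by (intro L2_norm_triangle_via lincomb_L2 f)
    also have "\<dots> \<le> e"
    proof -
      have "finite ?G" "F \<subseteq> ?G" "F' \<subseteq> ?G"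
        using F F' by auto
      then show ?thesis
        using 1[of ?G] 2[of ?G] L2_norm_minus_commute[of f "lincomb h ?G \<alpha>"] by linarith
    qed
    finally show ?thesis
      by simp
  qed
  then have "a * cmod (\<alpha> k - \<beta> k) \<le> 0"
    by (rule field_le_epsilon)
  then show "\<alpha> k = \<beta> k"
    using a by (simp add: mult_le_0_iff)
qed

text \<open>The lower bound makes the coefficients of a sequence of approximants Cauchy, uniformly
  over finite index sets. Their coordinatewise limits are the expansion coefficients, and the upper
  bound carries the convergence back to the functions.\<close>

lemma expansion_exists:
  assumes f: "f \<in> L2"
  shows "\<exists>\<alpha>. has_expansion h f \<alpha>"
proof -
  \<comment> \<open>Coefficients vanish off \<open>F\<close>, so two approximants can be compared
    over any larger common set.\<close>
  define P where "P n F b \<longleftrightarrow> finite F \<and> (\<forall>k. k \<notin> F \<longrightarrow> b k = 0)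
    \<and> L2_norm (\<lambda>x. f x - lincomb h F b x) < 1 / real (Suc n)" for n F b
  have "\<exists>F b. P n F b" for n
  proof -
    obtain F b where F: "finite F" "L2_norm (\<lambda>x. f x - lincomb h F b x) < 1 / real (Suc n)"
      using dense[OF f, of "1 / real (Suc n)"] by auto
    have "lincomb h F (\<lambda>k. if k \<in> F then b k else 0) = lincomb h F b"
      by (intro ext sum.cong) auto
    then show ?thesis
      using F by (intro exI[of _ F] exI[of _ "\<lambda>k. if k \<in> F then b k else 0"]) (simp add: P_def)
  qed
  then obtain F b where "\<And>n. P n (F n) (b n)"
    by metis
  then have F: "\<And>n. finite (F n)" and b: "\<And>n k. k \<notin> F n \<Longrightarrow> b n k = 0"
    and approx: "\<And>n. L2_norm (\<lambda>x. f x - lincomb h (F n) (b n) x) < 1 / real (Suc n)"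
    by (simp_all add: P_def)
  have diff: "a * L2_set (\<lambda>k. cmod (b n k - b m k)) G \<le> 1 / real (Suc n) + 1 / real (Suc m)"
    if "finite G" for n m G
  proof -
    let ?H = "G \<union> F n \<union> F m"
    have H: "finite ?H"
      using that F by auto
    have "L2_set (\<lambda>k. cmod (b n k - b m k)) G \<le> L2_set (\<lambda>k. cmod (b n k - b m k)) ?H"
      unfolding L2_set_def using H by (intro real_sqrt_le_mono sum_mono2) auto
    then have "a * L2_set (\<lambda>k. cmod (b n k - b m k)) G \<le> a * L2_set (\<lambda>k. cmod (b n k - b m k)) ?H"
      using a by simp
    also have "\<dots> \<le> L2_norm (lincomb h ?H (\<lambda>k. b n k - b m k))"
      by (rule lower[OF H])
    also have "lincomb h ?H (\<lambda>k. b n k - b m k) = (\<lambda>x. lincomb h ?H (b n) x - lincomb h ?H (b m) x)"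
      by (simp only: left_diff_distrib sum_subtractf)
    also have "\<dots> = (\<lambda>x. lincomb h (F n) (b n) x - lincomb h (F m) (b m) x)"
    proof -
      have "lincomb h ?H (b n) x = lincomb h (F n) (b n) x" "lincomb h ?H (b m) x = lincomb h (F m) (b m) x"
        for x
        by (rule lincomb_extend[OF H, symmetric]; use b in auto)+
      then show ?thesis
        by simp
    qed
    also have "L2_norm \<dots> \<le> L2_norm (\<lambda>x. lincomb h (F n) (b n) x - f x) + L2_norm (\<lambda>x. f x - lincomb h (F m) (b m) x)"
      by (intro L2_norm_triangle_via lincomb_L2 f)
    also have "\<dots> \<le> 1 / real (Suc n) + 1 / real (Suc m)"
      using approx[of n] approx[of m] L2_norm_minus_commute[of f "lincomb h (F n) (b n)"] by simp
    finally show ?thesis .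
  qed
  have "\<exists>l. (\<lambda>n. b n k) \<longlonglongrightarrow> l" for k
  proof -
    have bound: "cmod (b n k - b m k) \<le> (1 / real (Suc n) + 1 / real (Suc m)) / a" for n m
      using diff[of "{k}" n m] a by (simp add: L2_set_def pos_le_divide_eq mult.commute)
    have "Cauchy (\<lambda>n. b n k)"
    proof (rule CauchyI)
      fix e :: real
      assume e: "e > 0"
      then obtain N where N: "2 / (a * e) < real N"
        using reals_Archimedean2 by blast
      have "cmod (b m k - b n k) < e" if "m \<ge> N" "n \<ge> N" for m n
      proof -
        have "1 / real (Suc m) \<le> 1 / real (Suc N)" "1 / real (Suc n) \<le> 1 / real (Suc N)"
          using that by (auto simp: field_simps)
        then have "(1 / real (Suc m) + 1 / real (Suc n)) / a \<le> (2 / real (Suc N)) / a"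
          using a by (intro divide_right_mono) auto
        also have "\<dots> < e"
        proof -
          have "2 < real N * (a * e)"
            using N a e by (simp add: pos_divide_less_eq)
          also have "\<dots> \<le> real (Suc N) * (a * e)"
            using a e by (intro mult_right_mono) auto
          finally show ?thesis
            using a by (simp add: pos_divide_less_eq mult_ac)
        qed
        finally show ?thesis
          using bound[of m n] by linarith
      qed
      then show "\<exists>M. \<forall>m\<ge>M. \<forall>n\<ge>M. cmod (b m k - b n k) < e"
        by blast
    qed
    then show ?thesis
      using Cauchy_convergent_iff convergent_def by blast
  qed
  then obtain \<alpha> where \<alpha>: "\<And>k. (\<lambda>n. b n k) \<longlonglongrightarrow> \<alpha> k"
    by metis
  \<comment> \<open>Let \<open>m\<close> tend to infinity in \<open>diff\<close>. The resulting
    bound is independent of \<open>G\<close>.\<close>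
  have diff': "a * L2_set (\<lambda>k. cmod (b n k - \<alpha> k)) G \<le> 1 / real (Suc n)" if "finite G" for n G
  proof -
    have "(\<lambda>m. a * L2_set (\<lambda>k. cmod (b n k - b m k)) G) \<longlonglongrightarrow> a * L2_set (\<lambda>k. cmod (b n k - \<alpha> k)) G"
      unfolding L2_set_def by (intro tendsto_intros \<alpha>)
    moreover have "(\<lambda>m. 1 / real (Suc n) + 1 / real (Suc m)) \<longlonglongrightarrow> 1 / real (Suc n) + 0"
      using LIMSEQ_inverse_real_of_nat by (intro tendsto_intros) (simp add: inverse_eq_divide)
    ultimately have "a * L2_set (\<lambda>k. cmod (b n k - \<alpha> k)) G \<le> 1 / real (Suc n) + 0"
      using diff[OF that] by (intro LIMSEQ_le) auto
    then show ?thesis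
      by simp
  qed
  have "has_expansion h f \<alpha>"
    unfolding has_expansion_iff
  proof (intro allI impI)
    fix e :: real
    assume e: "e > 0"
    \<comment> \<open>The 1 pays for the approximation error at stage \<open>n\<close>, and
      \<open>c / a\<close> for replacing \<open>b n\<close> by its limit.\<close>
    define K where "K = 1 + c / a"
    have K: "K > 0"
      using a c by (simp add: K_def add_pos_nonneg)
    obtain n where n: "K / e < real n"
      using reals_Archimedean2 by blast
    have "L2_norm (\<lambda>x. f x - lincomb h G \<alpha> x) < e" if G: "finite G" "F n \<subseteq> G" for G
    proof -
      have "L2_norm (\<lambda>x. f x - lincomb h G \<alpha> x)
          \<le> L2_norm (\<lambda>x. f x - lincomb h G (b n) x) + L2_norm (\<lambda>x. lincomb h G (b n) x - lincomb h G \<alpha> x)"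
        by (intro L2_norm_triangle_via lincomb_L2 f)
      also have "(\<lambda>x. lincomb h G (b n) x - lincomb h G \<alpha> x) = lincomb h G (\<lambda>k. b n k - \<alpha> k)"
        by (simp only: left_diff_distrib sum_subtractf)
      also have "L2_norm \<dots> \<le> c * L2_set (\<lambda>k. cmod (b n k - \<alpha> k)) G"
        by (rule upper[OF G(1)])
      also have "\<dots> \<le> c * ((1 / real (Suc n)) / a)"
        using diff'[OF G(1), of n] a
        by (intro mult_left_mono c) (subst pos_le_divide_eq, simp_all add: mult.commute)
      also have "lincomb h G (b n) = lincomb h (F n) (b n)"
        by (intro ext lincomb_extend[symmetric] G b)
      also have "L2_norm (\<lambda>x. f x - lincomb h (F n) (b n) x) + c * ((1 / real (Suc n)) / a)
          \<le> K / real (Suc n)"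
        using approx[of n] by (simp add: K_def add_divide_distrib mult.commute)
      also have "\<dots> < e"
        using n e K by (simp add: field_simps)
      finally show ?thesis
        by simp
    qed
    then show "\<exists>F. finite F \<and> (\<forall>G. finite G \<longrightarrow> F \<subseteq> G \<longrightarrow> L2_norm (\<lambda>x. f x - lincomb h G \<alpha> x) < e)"
      using F by blast
  qed
  then show ?thesis
    by blast
qed

lemma expansion_ex1: "f \<in> L2 \<Longrightarrow> \<exists>!\<alpha>. has_expansion h f \<alpha>"
  using expansion_exists expansion_unique by blast

end

section \<open>The systems with shift of modulus less than one half\<close>

lemma Fsys_L2 [simp]: "Fsys \<xi> k \<in> L2"
  by (simp add: Fsys_def)

lemma L2_inner_Fsys:
  "L2_inner f (Fsys \<xi> k) = (if k \<ge> 0 then fourier f k else fourier (\<lambda>x. f x * expo (-\<xi>) x) k)"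
  by (simp add: Fsys_def L2_inner_expo_shift)

text \<open>Each sign of the index contributes one Bessel inequality, for \<open>f\<close> or for a
  modulation of \<open>f\<close> with the same norm; hence the constant 2.\<close>

lemma Fsys_Bessel_finite:
  assumes f: "f \<in> L2" and F: "finite F"
  shows "(\<Sum>k\<in>F. (cmod (L2_inner f (Fsys \<xi> k)))\<^sup>2) \<le> 2 * (L2_norm f)\<^sup>2"
proof -
  let ?P = "F \<inter> {0..}" and ?N = "F \<inter> {..<0}"
  have "(\<Sum>k\<in>F. (cmod (L2_inner f (Fsys \<xi> k)))\<^sup>2)
      = (\<Sum>k\<in>?P. (cmod (L2_inner f (Fsys \<xi> k)))\<^sup>2) + (\<Sum>k\<in>?N. (cmod (L2_inner f (Fsys \<xi> k)))\<^sup>2)"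
    using F by (subst sum.union_disjoint[symmetric]) (auto intro: sum.cong)
  also have "\<dots> = (\<Sum>k\<in>?P. (cmod (fourier f k))\<^sup>2)
      + (\<Sum>k\<in>?N. (cmod (fourier (\<lambda>x. f x * expo (-\<xi>) x) k))\<^sup>2)"
    by (auto simp: L2_inner_Fsys intro!: sum.cong arg_cong2[where f="(+)"])
  also have "\<dots> \<le> (L2_norm f)\<^sup>2 + (L2_norm (\<lambda>x. f x * expo (-\<xi>) x))\<^sup>2"
    using F f by (intro add_mono Bessel L2_mult_expo) auto
  finally show ?thesis
    by (simp add: L2_norm_mult_expo)
qed

lemma Fsys_Bessel:
  assumes f: "f \<in> L2"
  shows Fsys_square_summable: "(\<lambda>k. (cmod (L2_inner f (Fsys \<xi> k)))\<^sup>2) summable_on UNIV"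
    and Fsys_upper_bound: "(\<Sum>\<^sub>\<infinity>k. (cmod (L2_inner f (Fsys \<xi> k)))\<^sup>2) \<le> 2 * (L2_norm f)\<^sup>2"
proof -
  show *: "(\<lambda>k. (cmod (L2_inner f (Fsys \<xi> k)))\<^sup>2) summable_on UNIV"
    by (rule nonneg_bdd_above_summable_on)
      (auto intro!: bdd_aboveI[where M="2 * (L2_norm f)\<^sup>2"] Fsys_Bessel_finite f)
  show "(\<Sum>\<^sub>\<infinity>k. (cmod (L2_inner f (Fsys \<xi> k)))\<^sup>2) \<le> 2 * (L2_norm f)\<^sup>2"
    by (rule infsum_le_finite_sums[OF *]) (rule Fsys_Bessel_finite[OF f])
qed

lemma Fsys_frameI:
  assumes "A > 0" "\<And>f. f \<in> L2 \<Longrightarrow> A * (L2_norm f)\<^sup>2 \<le> (\<Sum>\<^sub>\<infinity>k. (cmod (L2_inner f (Fsys \<xi> k)))\<^sup>2)"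
  shows "is_frame (Fsys \<xi>)"
  unfolding is_frame_def
proof (intro exI conjI ballI)
  fix f
  assume f: "f \<in> L2"
  have "(\<Sum>\<^sub>\<infinity>k. (cmod (L2_inner f (Fsys \<xi> k)))\<^sup>2) \<le> 2 * (L2_norm f)\<^sup>2"
    by (rule Fsys_upper_bound[OF f])
  \<comment> \<open>The maximum is taken because the bounds in \<open>is_frame\<close> must be
    ordered.\<close>
  also have "\<dots> \<le> max A 2 * (L2_norm f)\<^sup>2"
    by (intro mult_right_mono) auto
  finally show "(\<Sum>\<^sub>\<infinity>k. (cmod (L2_inner f (Fsys \<xi> k)))\<^sup>2) \<le> max A 2 * (L2_norm f)\<^sup>2" .
qed (use assms Fsys_square_summable in auto)

section \<open>Perturbation of the orthonormal exponentials\<close>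

lemma L2_norm_trig_sum_L2_set:
  "finite F \<Longrightarrow> L2_norm (trig_sum F b) = L2_set (\<lambda>k. cmod (b k)) F"
  by (simp add: L2_set_def L2_norm_trig_sum[symmetric] L2_norm_nonneg)

text \<open>With \<open>t = pi * \<bar>\<xi>\<bar> / 2\<close>, the largest value of
  \<open>\<bar>pi * \<xi> * x\<bar>\<close> on \<open>I0\<close>, the cosine part deviates from 1 by
  at most \<open>1 - cos t\<close> and the sine part is at most \<open>sin t\<close>. For
  \<open>t\<close> below \<open>pi / 4\<close> the sine is smaller than the cosine, so the sum is
  below 1.\<close>

definition defect :: "real \<Rightarrow> real" where
  "defect \<xi> = 1 - cos (pi * \<bar>\<xi>\<bar> / 2) + sin (pi * \<bar>\<xi>\<bar> / 2)"

lemma defect_bounds: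
  assumes "\<bar>\<xi>\<bar> < 1/2"
  shows "0 \<le> defect \<xi>" "defect \<xi> < 1"
proof -
  define t where "t = pi * \<bar>\<xi>\<bar> / 2"
  have t: "0 \<le> t" "t < pi / 4"
    using assms mult_strict_left_mono[of "\<bar>\<xi>\<bar>" "1/2" pi] by (auto simp: t_def)
  have "sin t < sin (pi / 4)"
    using t by (intro sin_monotone_2pi) auto
  moreover have "cos (pi / 4) < cos t"
    using t by (intro cos_monotone_0_pi) auto
  ultimately show "defect \<xi> < 1"
    by (simp add: defect_def t_def[symmetric] sin_45 cos_45)
  show "0 \<le> defect \<xi>"
    using t sin_ge_zero[of t] cos_le_one[of t] unfolding defect_def t_def[symmetric] by linarith
qed

text \<open>Taking out half of the shift makes the two halves symmetric: nonnegative indices keep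
  the phase \<open>expo (-\<xi>/2)\<close>, negative ones its conjugate, so only the sign of the
  sine depends on \<open>k\<close>.\<close>

lemma Fsys_eq_rotated:
  "Fsys \<xi> k x = expo (\<xi>/2) x * ((of_real (cos (pi * \<xi> * x)) - \<i> * (if k \<ge> 0 then 1 else -1) * of_real (sin (pi * \<xi> * x)))
      * expo (of_int k) x)"
proof -
  have "of_real (cos (pi * \<xi> * x)) - \<i> * of_real (sin (pi * \<xi> * x)) = expo (-\<xi>/2) x"
    "of_real (cos (pi * \<xi> * x)) + \<i> * of_real (sin (pi * \<xi> * x)) = expo (\<xi>/2) x"
    by (simp_all add: expo_cis complex_eq_iff)
  moreover have "expo (\<xi>/2) x * expo (-\<xi>/2) x = 1" "expo (\<xi>/2) x * expo (\<xi>/2) x = expo \<xi> x"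
    by (simp_all add: expo_add[symmetric] expo_0)
  ultimately show ?thesis
    by (simp add: Fsys_def expo_add mult.assoc[symmetric])
qed

lemma Fsys_perturbation:
  assumes F: "finite F" and \<xi>: "\<bar>\<xi>\<bar> \<le> 1/2"
  shows "L2_norm (\<lambda>x. lincomb (Fsys \<xi>) F b x - trig_sum F b x * expo (\<xi>/2) x)
    \<le> defect \<xi> * L2_set (\<lambda>k. cmod (b k)) F"
proof -
  define t where "t = pi * \<bar>\<xi>\<bar> / 2"
  define p where "p = trig_sum F b"
  \<comment> \<open>The sign change by frequency is the norm-preserving operator \<open>H\<close> of
    the outline, so \<open>p'\<close> has the norm of \<open>p\<close>.\<close>
  define b' where "b' k = (if k \<ge> 0 then 1 else -1) * b k" for k
  define p' where "p' = trig_sum F b'"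
  define u where "u x = expo (\<xi>/2) x * (of_real (cos (pi * \<xi> * x)) - 1)" for x
  define v where "v x = expo (\<xi>/2) x * (\<i> * of_real (sin (pi * \<xi> * x)))" for x
  have pL2: "p \<in> L2" "p' \<in> L2"
    by (auto simp: p_def p'_def)
  have norms: "L2_norm p = L2_set (\<lambda>k. cmod (b k)) F" "L2_norm p' = L2_set (\<lambda>k. cmod (b k)) F"
    using F by (auto simp: p_def p'_def b'_def L2_norm_trig_sum_L2_set norm_mult intro!: L2_set_cong)
  have eq: "lincomb (Fsys \<xi>) F b x - trig_sum F b x * expo (\<xi>/2) x = p x * u x - p' x * v x" for x
  proof -
    have "lincomb (Fsys \<xi>) F b x = (\<Sum>k\<in>F. b k * expo (of_int k) x * (expo (\<xi>/2) x * of_real (cos (pi * \<xi> * x)))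
        - b' k * expo (of_int k) x * v x)"
      unfolding Fsys_eq_rotated b'_def v_def by (intro sum.cong refl) (simp add: algebra_simps)
    also have "\<dots> = p x * (expo (\<xi>/2) x * of_real (cos (pi * \<xi> * x))) - p' x * v x"
      by (simp only: p_def p'_def sum_subtractf sum_distrib_right)
    finally show ?thesis
      by (simp add: u_def p_def algebra_simps)
  qed
  have small: "\<bar>pi * \<xi> * x\<bar> \<le> t" "t \<le> pi / 2" if "x \<in> I0" for x
  proof -
    have "\<bar>x\<bar> \<le> 1/2"
      using that by (auto simp: I0_def)
    then have "pi * \<bar>\<xi>\<bar> * \<bar>x\<bar> \<le> pi * \<bar>\<xi>\<bar> * (1/2)"
      by (intro mult_left_mono) auto
    then show "\<bar>pi * \<xi> * x\<bar> \<le> t"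
      by (simp add: t_def abs_mult)
    show "t \<le> pi / 2"
      using \<xi> mult_left_mono[of "\<bar>\<xi>\<bar>" 1 pi] by (simp add: t_def)
  qed
  have cu: "cmod (u x) \<le> 1 - cos t" if "x \<in> I0" for x
  proof -
    have "cos t \<le> cos \<bar>pi * \<xi> * x\<bar>"
      using small[OF that] by (intro cos_monotone_0_pi_le) (auto simp: t_def)
    moreover have "cmod (u x) = \<bar>cos (pi * \<xi> * x) - 1\<bar>"
      unfolding u_def norm_mult norm_expo
      using norm_of_real[of "cos (pi * \<xi> * x) - 1", where 'a=complex] by simp
    ultimately show ?thesis
      by simp
  qed
  have cv: "cmod (v x) \<le> sin t" if "x \<in> I0" for x
  proof -
    have "sin \<bar>pi * \<xi> * x\<bar> \<le> sin t"
      using small[OF that] by (intro sin_monotone_2pi_le) auto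
    moreover have "\<bar>sin (pi * \<xi> * x)\<bar> = sin \<bar>pi * \<xi> * x\<bar>"
    proof -
      have "0 \<le> sin \<bar>pi * \<xi> * x\<bar>"
        by (rule sin_ge_zero) (use small[OF that] pi_gt_zero in linarith)+
      then show ?thesis
        by (auto simp: abs_if split: if_splits)
    qed
    ultimately show ?thesis
      by (simp add: v_def norm_mult)
  qed
  have uv: "u \<in> borel_measurable MI" "v \<in> borel_measurable MI"
    unfolding u_def v_def by (intro continuous_imp_measurable_MI continuous_intros)+
  have L2: "(\<lambda>x. p x * u x) \<in> L2" "(\<lambda>x. p' x * v x) \<in> L2"
    using cu cv uv pL2 by (auto intro: L2_mult_bounded)
  have t: "0 \<le> 1 - cos t" "0 \<le> sin t"
    using small[of 0] by (auto simp: I0_def t_def intro!: sin_ge_zero)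
  have "L2_norm (\<lambda>x. p x * u x - p' x * v x) \<le> L2_norm (\<lambda>x. p x * u x) + L2_norm (\<lambda>x. p' x * v x)"
    by (intro L2_norm_triangle_diff L2)
  also have "\<dots> \<le> (1 - cos t) * L2_norm p + sin t * L2_norm p'"
  proof (intro add_mono L2_norm_mono L2 pL2 t)
    fix x
    assume x: "x \<in> I0"
    show "cmod (p x * u x) \<le> (1 - cos t) * cmod (p x)"
      unfolding norm_mult mult.commute[of "cmod (p x)"] by (intro mult_right_mono cu x norm_ge_zero)
    show "cmod (p' x * v x) \<le> sin t * cmod (p' x)"
      unfolding norm_mult mult.commute[of "cmod (p' x)"] by (intro mult_right_mono cv x norm_ge_zero)
  qed
  also have "\<dots> = defect \<xi> * L2_set (\<lambda>k. cmod (b k)) F"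
    by (simp add: norms defect_def t_def algebra_simps)
  finally show ?thesis
    by (simp only: eq)
qed

lemma Fsys_bounds:
  assumes F: "finite F" and \<xi>: "\<bar>\<xi>\<bar> < 1/2"
  shows "(1 - defect \<xi>) * L2_set (\<lambda>k. cmod (b k)) F \<le> L2_norm (lincomb (Fsys \<xi>) F b)"
    and "L2_norm (lincomb (Fsys \<xi>) F b) \<le> (1 + defect \<xi>) * L2_set (\<lambda>k. cmod (b k)) F"
proof -
  let ?p = "\<lambda>x. trig_sum F b x * expo (\<xi>/2) x" and ?H = "lincomb (Fsys \<xi>) F b"
  have L2: "?p \<in> L2" "?H \<in> L2"
    by (auto intro: L2_mult_expo L2_sum)
  have "L2_norm ?p = L2_set (\<lambda>k. cmod (b k)) F"
    using F by (simp only: L2_norm_mult_expo L2_norm_trig_sum_L2_set)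
  moreover have "L2_norm (\<lambda>x. ?H x - ?p x) \<le> defect \<xi> * L2_set (\<lambda>k. cmod (b k)) F"
    using Fsys_perturbation[OF F, of \<xi> b] \<xi> by simp
  ultimately show "(1 - defect \<xi>) * L2_set (\<lambda>k. cmod (b k)) F \<le> L2_norm ?H"
    "L2_norm ?H \<le> (1 + defect \<xi>) * L2_set (\<lambda>k. cmod (b k)) F"
    using L2_norm_diff_lower[OF L2] L2_norm_diff_lower[OF L2(2,1)] L2_norm_minus_commute[of ?H ?p]
    by (auto simp: algebra_simps)
qed

text \<open>Truncate the Fourier series of \<open>f\<close> times \<open>expo (-\<xi>/2)\<close> and
  reuse its coefficients for the shifted system. The gap \<open>r - defect \<xi>\<close> pays for
  the truncation, and Bessel bounds the coefficients.\<close>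

lemma Fsys_approximation_step:
  assumes f: "f \<in> L2" and \<xi>: "\<bar>\<xi>\<bar> < 1/2" and r: "defect \<xi> < r"
  shows "\<exists>F b. finite F \<and> L2_set (\<lambda>k. cmod (b k)) F \<le> L2_norm f \<and>
    L2_norm (\<lambda>x. f x - lincomb (Fsys \<xi>) F b x) \<le> r * L2_norm f"
proof (cases "L2_norm f = 0")
  case True
  then show ?thesis
    by (intro exI[of _ "{}"]) simp
next
  case False
  then have pos: "(r - defect \<xi>) * L2_norm f > 0"
    using r L2_norm_nonneg[of f] by (intro mult_pos_pos) auto
  define g where "g x = f x * expo (-\<xi>/2) x" for x
  have g: "g \<in> L2" "L2_norm g = L2_norm f"
    unfolding g_def using f by (auto simp: L2_norm_mult_expo intro: L2_mult_expo)
  obtain F where F: "finite F"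
    "L2_norm (\<lambda>x. g x - trig_sum F (fourier g) x) < (r - defect \<xi>) * L2_norm f"
    using fourier_approximation[OF g(1) pos] by blast
  let ?b = "fourier g"
  let ?p = "\<lambda>x. trig_sum F ?b x * expo (\<xi>/2) x" and ?H = "lincomb (Fsys \<xi>) F ?b"
  have L2: "?p \<in> L2" "?H \<in> L2"
    by (auto intro: L2_mult_expo L2_sum)
  have b: "L2_set (\<lambda>k. cmod (?b k)) F \<le> L2_norm f"
    unfolding L2_set_def using Bessel[OF g(1) F(1)] g(2) by (intro real_le_lsqrt) (auto simp: L2_norm_nonneg)
  have "f x = g x * expo (\<xi>/2) x" for x
    by (simp add: g_def mult.assoc expo_add[symmetric] expo_0)
  then have "(\<lambda>x. f x - ?p x) = (\<lambda>x. (g x - trig_sum F ?b x) * expo (\<xi>/2) x)"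
    by (simp add: left_diff_distrib)
  then have 1: "L2_norm (\<lambda>x. f x - ?p x) \<le> (r - defect \<xi>) * L2_norm f"
    using F(2) by (simp only: L2_norm_mult_expo)
  have "L2_norm (\<lambda>x. ?p x - ?H x) \<le> defect \<xi> * L2_set (\<lambda>k. cmod (?b k)) F"
    using Fsys_perturbation[OF F(1), of \<xi> ?b] \<xi> L2_norm_minus_commute[of ?p ?H] by simp
  also have "\<dots> \<le> defect \<xi> * L2_norm f"
    using b defect_bounds(1)[OF \<xi>] by (rule mult_left_mono)
  finally have "L2_norm (\<lambda>x. f x - ?H x) \<le> r * L2_norm f"
    using 1 L2_norm_triangle_via[OF f L2] by (simp add: left_diff_distrib)
  then show ?thesis
    using F(1) b by (intro exI[of _ F] exI[of _ ?b] conjI)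
qed

text \<open>A Neumann iteration: the approximation step, applied to the successive remainders,
  shrinks them by a fixed factor \<open>r < 1\<close>.\<close>

lemma Fsys_dense:
  assumes f: "f \<in> L2" and \<xi>: "\<bar>\<xi>\<bar> < 1/2" and e: "e > 0"
  shows "\<exists>F b. finite F \<and> L2_norm (\<lambda>x. f x - lincomb (Fsys \<xi>) F b x) < e"
proof -
  obtain r where r: "defect \<xi> < r" "r < 1"
    using defect_bounds[OF \<xi>] dense by blast
  have iterate: "\<exists>F b. finite F \<and> L2_norm (\<lambda>x. f x - lincomb (Fsys \<xi>) F b x) \<le> r ^ n * L2_norm f"
    for n
  proof (induction n)
    case 0
    show ?case
      by (intro exI[of _ "{}"]) simp
  next
    case (Suc n)
    then obtain F b where F: "finite F" "L2_norm (\<lambda>x. f x - lincomb (Fsys \<xi>) F b x) \<le> r ^ n * L2_norm f"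
      by blast
    let ?f = "\<lambda>x. f x - lincomb (Fsys \<xi>) F b x"
    have "?f \<in> L2"
      by (intro L2_diff f L2_sum) simp
    then obtain F' b' where F': "finite F'"
      "L2_norm (\<lambda>x. ?f x - lincomb (Fsys \<xi>) F' b' x) \<le> r * L2_norm ?f"
      using Fsys_approximation_step[OF _ \<xi> r(1)] by blast
    define c where "c k = (if k \<in> F then b k else 0) + (if k \<in> F' then b' k else 0)" for k
    have "lincomb (Fsys \<xi>) (F \<union> F') c x = lincomb (Fsys \<xi>) F b x + lincomb (Fsys \<xi>) F' b' x" for x
    proof -
      have "lincomb (Fsys \<xi>) (F \<union> F') c x = (\<Sum>k\<in>F\<union>F'. (if k \<in> F then b k * Fsys \<xi> k x else 0))
          + (\<Sum>k\<in>F\<union>F'. (if k \<in> F' then b' k * Fsys \<xi> k x else 0))"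
        unfolding c_def sum.distrib[symmetric] by (intro sum.cong refl) (auto simp: distrib_right)
      then show ?thesis
        using F(1) F'(1) by (simp add: sum.If_cases Int_absorb1 Int_absorb2)
    qed
    then have "(\<lambda>x. ?f x - lincomb (Fsys \<xi>) F' b' x) = (\<lambda>x. f x - lincomb (Fsys \<xi>) (F \<union> F') c x)"
      by (simp add: algebra_simps)
    moreover have "r * L2_norm ?f \<le> r ^ Suc n * L2_norm f"
      using F(2) r defect_bounds(1)[OF \<xi>] mult_left_mono[of "L2_norm ?f" "r ^ n * L2_norm f" r]
      by (simp add: mult.assoc)
    ultimately have "L2_norm (\<lambda>x. f x - lincomb (Fsys \<xi>) (F \<union> F') c x) \<le> r ^ Suc n * L2_norm f"
      using F'(2) by simp
    then show ?case
      using F(1) F'(1) by blast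
  qed
  have "(\<lambda>n. r ^ n * L2_norm f) \<longlonglongrightarrow> 0 * L2_norm f"
    using r defect_bounds(1)[OF \<xi>] by (intro tendsto_intros LIMSEQ_realpow_zero) auto
  then obtain n where "r ^ n * L2_norm f < e"
    using order_tendstoD(2)[of _ "0 * L2_norm f" sequentially e] e by (auto simp: eventually_sequentially)
  then show ?thesis
    using iterate[of n] by (meson le_less_trans)
qed

text \<open>Pair \<open>f\<close> with itself and split off one approximant \<open>H\<close>. The
  remainder takes up at most the fraction \<open>r\<close> of the squared norm; the pairing with
  \<open>H\<close> is at most \<open>L2_norm f * sqrt S\<close>, because the coefficients of
  \<open>H\<close> have l2 norm at most \<open>L2_norm f\<close>.\<close>

lemma Fsys_lower_frame_bound:
  assumes f: "f \<in> L2" and \<xi>: "\<bar>\<xi>\<bar> < 1/2"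
  shows "((1 - defect \<xi>) / 2)\<^sup>2 * (L2_norm f)\<^sup>2 \<le> (\<Sum>\<^sub>\<infinity>k. (cmod (L2_inner f (Fsys \<xi> k)))\<^sup>2)"
proof -
  define S where "S = (\<Sum>\<^sub>\<infinity>k. (cmod (L2_inner f (Fsys \<xi> k)))\<^sup>2)"
  \<comment> \<open>The midpoint between \<open>defect \<xi>\<close> and 1; its distance to 1 is the
    constant of the bound.\<close>
  define r where "r = (1 + defect \<xi>) / 2"
  have r: "defect \<xi> < r" "r < 1" "1 - r = (1 - defect \<xi>) / 2"
    using defect_bounds[OF \<xi>] by (auto simp: r_def field_simps)
  obtain F b where F: "finite F" and b: "L2_set (\<lambda>k. cmod (b k)) F \<le> L2_norm f"
    and approx: "L2_norm (\<lambda>x. f x - lincomb (Fsys \<xi>) F b x) \<le> r * L2_norm f"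
    using Fsys_approximation_step[OF f \<xi> r(1)] by blast
  let ?H = "lincomb (Fsys \<xi>) F b"
  have H: "?H \<in> L2"
    by (intro L2_sum) simp
  have S: "L2_set (\<lambda>k. cmod (L2_inner f (Fsys \<xi> k))) F \<le> sqrt S"
    unfolding L2_set_def S_def
    by (intro real_sqrt_le_mono finite_sum_le_infsum Fsys_square_summable f F) auto
  have "cmod (L2_inner f ?H) \<le> (\<Sum>k\<in>F. \<bar>cmod (b k)\<bar> * \<bar>cmod (L2_inner f (Fsys \<xi> k))\<bar>)"
    using f by (subst L2_inner_sum_right) (auto simp: norm_mult intro!: sum_norm_le)
  also have "\<dots> \<le> L2_set (\<lambda>k. cmod (b k)) F * L2_set (\<lambda>k. cmod (L2_inner f (Fsys \<xi> k))) F"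
    by (rule L2_set_mult_ineq)
  also have "\<dots> \<le> L2_norm f * sqrt S"
    using b S by (intro mult_mono) (auto simp: L2_norm_nonneg)
  finally have 1: "cmod (L2_inner f ?H) \<le> L2_norm f * sqrt S" .
  have "cmod (L2_inner f (\<lambda>x. f x - ?H x)) \<le> L2_norm f * (r * L2_norm f)"
    using L2_Cauchy_Schwarz[OF f L2_diff[OF f H]] mult_left_mono[OF approx L2_norm_nonneg[of f]] by linarith
  moreover have "cmod (L2_inner f f) \<le> cmod (L2_inner f (\<lambda>x. f x - ?H x)) + cmod (L2_inner f ?H)"
  proof -
    have split: "L2_inner f f = L2_inner f (\<lambda>x. f x - ?H x) + L2_inner f ?H"
      using f H by (simp add: L2_inner_diff_right)
    show ?thesis
      unfolding split by (rule norm_triangle_ineq)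
  qed
  moreover have "cmod (L2_inner f f) = L2_norm f * L2_norm f"
    unfolding L2_inner_self norm_of_real by (simp add: power2_eq_square)
  ultimately have "L2_norm f * ((1 - r) * L2_norm f) \<le> L2_norm f * sqrt S"
    using 1 by (simp add: algebra_simps)
  then have "(1 - r) * L2_norm f \<le> sqrt S"
    using L2_norm_nonneg[of f] infsum_nonneg[of UNIV "\<lambda>k. (cmod (L2_inner f (Fsys \<xi> k)))\<^sup>2"]
    by (cases "L2_norm f = 0") (auto simp: S_def)
  then have "((1 - r) * L2_norm f)\<^sup>2 \<le> (sqrt S)\<^sup>2"
    using r(2) L2_norm_nonneg[of f] by (intro power_mono) auto
  moreover have "0 \<le> S"
    unfolding S_def by (rule infsum_nonneg) simp
  ultimately show ?thesis
    by (simp add: r(3) power_mult_distrib power_divide S_def)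
qed

lemma Fsys_riesz_basis:
  assumes \<xi>: "\<bar>\<xi>\<bar> < 1/2"
  shows "riesz_basis (Fsys \<xi>)"
proof -
  interpret riesz_system "Fsys \<xi>" "1 - defect \<xi>" "1 + defect \<xi>"
    using defect_bounds[OF \<xi>] Fsys_bounds[OF _ \<xi>] Fsys_dense[OF _ \<xi>] by unfold_locales auto
  show ?thesis
    unfolding riesz_basis_def
    using Fsys_frameI[OF _ Fsys_lower_frame_bound[OF _ \<xi>]] defect_bounds[OF \<xi>] expansion_ex1
    by simp
qed

section \<open>Powers of the cosine and their orthogonality relations\<close>

lemma cos_pi_nonneg: "x \<in> I0 \<Longrightarrow> 0 \<le> cos (pi * x)"
  using mult_left_mono[of x "1/2" pi] mult_left_mono[of "-1/2" x pi]
  by (intro cos_ge_zero) (auto simp: I0_def)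

lemma cos_pi_pos: "-1/2 < x \<Longrightarrow> x < 1/2 \<Longrightarrow> 0 < cos (pi * x)"
  using mult_strict_left_mono[of x "1/2" pi] mult_strict_left_mono[of "-1/2" x pi]
  by (intro cos_gt_zero_pi) auto

lemma cos_powr_measurable [measurable]: "(\<lambda>x. cos (pi * x) powr b) \<in> borel_measurable MI"
proof -
  have [measurable]: "(\<lambda>x. cos (pi * x)) \<in> borel_measurable MI"
    by (intro continuous_imp_measurable_MI continuous_intros)
  show ?thesis
    by measurable
qed

lemma cos_powr_continuous:
  assumes "b > 0" "S \<subseteq> I0"
  shows "continuous_on S (\<lambda>x. cos (pi * x) powr b)"
  using assms cos_pi_nonneg by (intro continuous_on_powr' continuous_intros) auto

lemma cos_powr_derivative:
  assumes "-1/2 < x" "x < 1/2"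
  shows "((\<lambda>x. cos (pi * x) powr (b + 1)) has_real_derivative
    - (pi * (b + 1) * (sin (pi * x) * cos (pi * x) powr b))) (at x)"
  using cos_pi_pos[OF assms] by (auto intro!: derivative_eq_intros)

text \<open>The antiderivative is a multiple of the cosine to the power \<open>b + 1\<close>. As
  \<open>b > -1\<close>, it is continuous up to the endpoints, where the integrand may blow
  up.\<close>

lemma has_integral_sin_cos_powr:
  assumes b: "b > -1" and uv: "-1/2 \<le> u" "u \<le> v" "v \<le> 1/2"
  shows "((\<lambda>x. sin (pi * x) * cos (pi * x) powr b) has_integral
    (cos (pi * u) powr (b + 1) - cos (pi * v) powr (b + 1)) / (pi * (b + 1))) {u..v}"
proof -
  let ?G = "\<lambda>x. cos (pi * x) powr (b + 1) * (- 1 / (pi * (b + 1)))"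
  have "((\<lambda>x. sin (pi * x) * cos (pi * x) powr b) has_integral ?G v - ?G u) {u..v}"
  proof (rule fundamental_theorem_of_calculus_interior)
    show "continuous_on {u..v} ?G"
      using b uv by (intro continuous_on_mult cos_powr_continuous continuous_on_const) (auto simp: I0_def)
    fix x
    assume "x \<in> {u<..<v}"
    then have x: "-1/2 < x" "x < 1/2"
      using uv by auto
    have "(?G has_real_derivative - (pi * (b + 1) * (sin (pi * x) * cos (pi * x) powr b)) * (- 1 / (pi * (b + 1)))) (at x)"
      by (intro DERIV_cmult_right cos_powr_derivative x)
    then show "(?G has_vector_derivative sin (pi * x) * cos (pi * x) powr b) (at x)"
      using b by (simp add: has_real_derivative_iff_has_vector_derivative)
  qed (use uv in simp)
  then show ?thesis
    by (simp add: diff_divide_distrib)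
qed

lemma abs_sin_cos_powr:
  assumes b: "b > -1"
  shows "integrable MI (\<lambda>x. \<bar>sin (pi * x)\<bar> * cos (pi * x) powr b)"
    and "(LINT x|MI. \<bar>sin (pi * x)\<bar> * cos (pi * x) powr b) = 2 / (pi * (b + 1))"
proof -
  let ?f = "\<lambda>x. \<bar>sin (pi * x)\<bar> * cos (pi * x) powr b"
  have "(?f has_integral 1 / (pi * (b + 1))) {0..1/2}"
  proof (rule has_integral_eq[rotated])
    show "((\<lambda>x. sin (pi * x) * cos (pi * x) powr b) has_integral 1 / (pi * (b + 1))) {0..1/2}"
      using has_integral_sin_cos_powr[OF b, of 0 "1/2"] by simp
    fix x :: real
    assume "x \<in> {0..1/2}"
    then have "0 \<le> sin (pi * x)"
      using mult_left_mono[of x 1 pi] by (intro sin_ge_zero) auto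
    then show "sin (pi * x) * cos (pi * x) powr b = ?f x"
      by simp
  qed
  moreover have "(?f has_integral 1 / (pi * (b + 1))) {-1/2..0}"
  proof (rule has_integral_eq[rotated])
    show "((\<lambda>x. - (sin (pi * x) * cos (pi * x) powr b)) has_integral 1 / (pi * (b + 1))) {-1/2..0}"
      using has_integral_neg[OF has_integral_sin_cos_powr[OF b, of "-1/2" 0]] by simp
    fix x :: real
    assume "x \<in> {-1/2..0}"
    then have "0 \<le> sin (pi * (- x))"
      using mult_left_mono[of "-x" 1 pi] mult_left_mono[of 0 "-x" pi] by (intro sin_ge_zero) auto
    then show "- (sin (pi * x) * cos (pi * x) powr b) = ?f x"
      by simp
  qed
  ultimately have I: "(?f has_integral 2 / (pi * (b + 1))) I0"
    using has_integral_combine[of "-1/2" 0 "1/2" ?f] unfolding I0_def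
    by (fastforce simp: add_divide_distrib[symmetric])
  then have "?f absolutely_integrable_on I0"
    by (intro nonnegative_absolutely_integrable_1) (auto simp: integrable_on_def)
  then show *: "integrable MI ?f"
    using I0_lmeasurable by (subst integrable_restrict_space) (auto simp: set_integrable_def)
  show "(LINT x|MI. ?f x) = 2 / (pi * (b + 1))"
    using I I0_lmeasurable by (subst lebesgue_integral_eq_integral[OF *]) auto
qed

text \<open>Near the endpoints the sine has modulus close to 1 and carries the singularity: with
  \<open>s\<close> and \<open>c\<close> as below, \<open>(1 - s) * c powr b\<close> is at most
  \<open>c powr (2 + b)\<close>, hence at most 1. Where the cosine is zero, \<open>powr\<close> has
  the value 0.\<close>

lemma cos_powr_le:
  assumes b: "b > -1" and x: "x \<in> I0"
  shows "cos (pi * x) powr b \<le> 1 + \<bar>sin (pi * x)\<bar> * cos (pi * x) powr b"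
proof (cases "cos (pi * x) = 0")
  case False
  define c s where "c = cos (pi * x)" and "s = \<bar>sin (pi * x)\<bar>"
  have c: "0 < c" "c \<le> 1"
    using cos_pi_nonneg[OF x] False by (auto simp: c_def)
  have s: "0 \<le> s" "s \<le> 1"
    by (auto simp: s_def)
  have "1 - s \<le> (1 - s) * (1 + s)"
    using s mult_left_mono[of 1 "1 + s" "1 - s"] by simp
  also have "\<dots> = c\<^sup>2"
    using sin_cos_squared_add[of "pi * x"] by (simp add: c_def s_def power2_eq_square algebra_simps)
  finally have "(1 - s) * c powr b \<le> c\<^sup>2 * c powr b"
    by (intro mult_right_mono) auto
  also have "\<dots> = c powr (2 + b)"
    using c by (simp add: powr_add)
  also have "\<dots> \<le> 1"
    using c b by (intro powr_le1) auto
  finally show ?thesis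
    by (simp add: c_def s_def algebra_simps)
qed simp

text \<open>The upper estimate will keep the coefficients of \<open>sing a\<close> bounded, while
  the lower one forces its norm to infinity at the critical exponent.\<close>

lemma cos_powr_integrable:
  assumes b: "b > -1"
  shows "integrable MI (\<lambda>x. cos (pi * x) powr b)"
    and "(LINT x|MI. cos (pi * x) powr b) \<le> 1 + 2 / (pi * (b + 1))"
    and "2 / (pi * (b + 1)) \<le> (LINT x|MI. cos (pi * x) powr b)"
proof -
  let ?f = "\<lambda>x. \<bar>sin (pi * x)\<bar> * cos (pi * x) powr b"
  have one: "integrable MI (\<lambda>x. 1::real)"
    by (rule integrable_MI_bounded[of _ 1]) auto
  then have int: "integrable MI (\<lambda>x. 1 + ?f x)"
    using abs_sin_cos_powr(1)[OF b] by simp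
  show *: "integrable MI (\<lambda>x. cos (pi * x) powr b)"
    by (rule Bochner_Integration.integrable_bound[OF int]) (auto intro!: AE_I2 cos_powr_le[OF b, THEN order_trans])
  have "(LINT x|MI. cos (pi * x) powr b) \<le> (LINT x|MI. 1 + ?f x)"
    using cos_powr_le[OF b] by (intro integral_mono * int) auto
  also have "\<dots> = 1 + 2 / (pi * (b + 1))"
    using abs_sin_cos_powr[OF b] one measure_MI by simp
  finally show "(LINT x|MI. cos (pi * x) powr b) \<le> 1 + 2 / (pi * (b + 1))" .
  have "?f x \<le> cos (pi * x) powr b" for x
    by (rule mult_left_le_one_le) auto
  then show "2 / (pi * (b + 1)) \<le> (LINT x|MI. cos (pi * x) powr b)"
    unfolding abs_sin_cos_powr(2)[OF b, symmetric] by (intro integral_mono * abs_sin_cos_powr(1)[OF b])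
qed

text \<open>The Fourier transform of a cosine power, classically a quotient of Gamma values. Only
  its zeros matter here; the recurrence below produces them.\<close>

definition cosJ :: "real \<Rightarrow> real \<Rightarrow> complex" where
  "cosJ a s = (LINT x|MI. of_real (cos (pi * x) powr a) * expo s x)"

lemma cosJ_integrable:
  assumes "a > -1"
  shows "integrable MI (\<lambda>x. of_real (cos (pi * x) powr a) * expo s x)"
  by (rule Bochner_Integration.integrable_bound[OF cos_powr_integrable(1)[OF assms]])
    (auto simp: norm_mult)

lemma cnj_cosJ: "cnj (cosJ a s) = cosJ a (- s)"
  unfolding cosJ_def Bochner_Integration.integral_cnj[symmetric] by (simp add: cnj_expo)

text \<open>Integrate the derivative of \<open>cos (\<pi>x) powr (a+1) * expo (s + 1/2) x\<close>, which vanishes at both ends.\<close>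

lemma cosJ_recurrence:
  assumes a: "a > -1"
  shows "of_real (s + 1 + a/2) * cosJ a (s + 1) = of_real (a/2 - s) * cosJ a s"
proof -
  define D where "D x = \<i> * of_real pi * (of_real (s + 1 + a/2) * (of_real (cos (pi * x) powr a) * expo (s + 1) x)
      - of_real (a/2 - s) * (of_real (cos (pi * x) powr a) * expo s x))" for x
  let ?G = "\<lambda>x. of_real (cos (pi * x) powr (a + 1)) * expo (s + 1/2) x"
  have "(D has_integral ?G (1/2) - ?G (-1/2)) {-1/2..1/2}"
  proof (rule fundamental_theorem_of_calculus_interior)
    show "continuous_on {-1/2..1/2} ?G"
      using a by (intro continuous_intros cos_powr_continuous) (auto simp: I0_def)
    fix x :: real
    assume "x \<in> {-1/2<..<1/2}"
    then have x: "-1/2 < x" "x < 1/2"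
      by auto
    define c where "c = cos (pi * x)"
    define z where "z = expo (1/2) x"
    define z' where "z' = expo (-1/2) x"
    have zz: "z * z' = 1"
      by (simp add: z_def z'_def expo_add[symmetric] expo_0)
    \<comment> \<open>In terms of \<open>z\<close> and its inverse \<open>z'\<close> the derivative
      of the product becomes an algebraic identity.\<close>
    have trig: "complex_of_real (cos (pi * x)) = (z + z') / 2"
      "complex_of_real (sin (pi * x)) = (z' - z) * \<i> / 2"
      by (simp_all add: z_def z'_def expo_cis complex_eq_iff)
    have e: "expo (s + 1) x = expo s x * (z * z)" "expo (s + 1/2) x = expo s x * z"
      by (simp_all add: z_def expo_add[symmetric])
    have "cos (pi * x) powr (a + 1) = c * cos (pi * x) powr a"
      using cos_pi_pos[OF x] by (simp add: c_def powr_add)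
    then have p: "complex_of_real (cos (pi * x) powr (a + 1)) = (z + z') / 2 * of_real (cos (pi * x) powr a)"
      using trig(1) by (simp add: c_def)
    have d1: "((\<lambda>x. complex_of_real (cos (pi * x) powr (a + 1))) has_vector_derivative
        of_real (- (pi * (a + 1) * (sin (pi * x) * cos (pi * x) powr a)))) (at x)"
      by (rule has_vector_derivative_of_real)
        (use cos_powr_derivative[OF x, of a] in \<open>simp add: has_real_derivative_iff_has_vector_derivative\<close>)
    have "(?G has_vector_derivative of_real (cos (pi * x) powr (a + 1)) * ((2 * pi * (s + 1/2) * \<i>) * expo (s + 1/2) x)
        + of_real (- (pi * (a + 1) * (sin (pi * x) * cos (pi * x) powr a))) * expo (s + 1/2) x) (at x)"
      by (intro has_vector_derivative_mult d1 expo_has_vector_derivative)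
    also have "of_real (cos (pi * x) powr (a + 1)) * ((2 * pi * (s + 1/2) * \<i>) * expo (s + 1/2) x)
        + of_real (- (pi * (a + 1) * (sin (pi * x) * cos (pi * x) powr a))) * expo (s + 1/2) x
      = of_real pi * of_real (cos (pi * x) powr a) * expo s x * \<i> *
        ((of_real s + 1/2) * (z * z + z * z') - (of_real a + 1) / 2 * (z * z' - z * z))"
      unfolding p e of_real_minus of_real_mult trig(2) by (simp add: field_simps)
    also have "\<dots> = D x"
      unfolding D_def e zz by (simp add: field_simps)
    finally show "(?G has_vector_derivative D x) (at x)" .
  qed simp
  then have "integral {-1/2..1/2} D = 0"
    by (simp add: integral_unique)
  moreover have D: "integrable MI D"
    unfolding D_def using a
    by (intro integrable_mult_right Bochner_Integration.integrable_diff cosJ_integrable)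
  ultimately have "(LINT x|MI. D x) = 0"
    using I0_lmeasurable by (subst lebesgue_integral_eq_integral) (auto simp: I0_def)
  moreover have "(LINT x|MI. D x) = \<i> * of_real pi * (of_real (s + 1 + a/2) * cosJ a (s + 1) - of_real (a/2 - s) * cosJ a s)"
    unfolding D_def cosJ_def using cosJ_integrable[OF a]
    by (simp only: integral_mult_right_zero Bochner_Integration.integral_diff integrable_mult_right)
  ultimately show ?thesis
    by simp
qed

text \<open>At \<open>s = a/2\<close> the right side of the recurrence vanishes while the left
  factor is \<open>a + 1\<close>. Further steps propagate the zero, since the left factors stay
  positive.\<close>

lemma cosJ_zero:
  assumes a: "a > -1"
  shows "cosJ a (a/2 + real (Suc m)) = 0"
proof (induction m)
  case 0
  have "of_real (a/2 + 1 + a/2) * cosJ a (a/2 + 1) = 0"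
    unfolding cosJ_recurrence[OF a, of "a/2"] by (simp only: diff_self of_real_0 mult_zero_left)
  moreover have "a/2 + 1 + a/2 \<noteq> 0"
    using a by simp
  ultimately show ?case
    by (simp only: mult_eq_0_iff of_real_eq_0_iff simp_thms of_nat_Suc of_nat_0 add_0_right)
next
  case (Suc m)
  have "a/2 + real (Suc m) + 1 + a/2 \<noteq> 0"
    using a by simp
  moreover have "of_real (a/2 + real (Suc m) + 1 + a/2) * cosJ a (a/2 + real (Suc m) + 1) = 0"
    unfolding cosJ_recurrence[OF a, of "a/2 + real (Suc m)"] Suc.IH by (rule mult_zero_right)
  ultimately have "cosJ a (a/2 + real (Suc m) + 1) = 0"
    by (simp only: mult_eq_0_iff of_real_eq_0_iff simp_thms)
  then show ?case
    by (simp add: add_ac)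
qed

text \<open>The frequency is chosen so that the inner products with both halves of
  \<open>Fsys (-1 - a)\<close> are values of \<open>cosJ a\<close> at the zeros
  \<open>a/2 + 1, a/2 + 2, ...\<close> or their negatives.\<close>

definition sing :: "real \<Rightarrow> real \<Rightarrow> complex" where
  "sing a x = of_real (cos (pi * x) powr a) * expo (- 1 - a/2) x"

lemma cmod_sing: "cmod (sing a x) = cos (pi * x) powr a"
  by (simp add: sing_def norm_mult)

section \<open>Size and coefficients of the singular functions\<close>

lemma cmod_sing_square: "x \<in> I0 \<Longrightarrow> (cmod (sing a x))\<^sup>2 = cos (pi * x) powr (2 * a)"
  using powr_power[of "cos (pi * x)" a 2] by (cases "cos (pi * x) = 0") (auto simp: cmod_sing)

lemma sing_measurable [measurable]: "sing a \<in> borel_measurable MI"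
  unfolding sing_def by measurable

lemma sing_L2:
  assumes a: "a > -1/2"
  shows "sing a \<in> L2"
proof -
  have "integrable MI (\<lambda>x. cos (pi * x) powr (2 * a))"
    using a by (intro cos_powr_integrable) auto
  then have "integrable MI (\<lambda>x. (cmod (sing a x))\<^sup>2)"
    by (rule Bochner_Integration.integrable_cong[THEN iffD1, rotated 2]) (auto simp: cmod_sing_square)
  then show ?thesis
    by (simp add: L2_def)
qed

lemma sing_norm:
  assumes a: "a > -1/2"
  shows "2 / (pi * (2 * a + 1)) \<le> (L2_norm (sing a))\<^sup>2"
proof -
  have "(L2_norm (sing a))\<^sup>2 = (LINT x|MI. cos (pi * x) powr (2 * a))"
    unfolding L2_norm_square by (intro Bochner_Integration.integral_cong) (auto simp: cmod_sing_square)
  then show ?thesis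
    using cos_powr_integrable(3)[of "2 * a"] a by simp
qed

lemma L2_inner_sing: "L2_inner (sing a) (expo t) = cosJ a (- 1 - a/2 - t)"
  by (simp add: L2_inner_def cosJ_def sing_def cnj_expo mult.assoc expo_add[symmetric])

text \<open>The coefficients are bounded by the integral of the modulus, which stays finite down to
  \<open>a = -1/2\<close>, in contrast to the norm. Since \<open>pi * (a + 1)\<close> is at least 1
  there, 3 suffices for all frequencies.\<close>

lemma L2_inner_sing_bound:
  assumes a: "a \<ge> -1/2"
  shows "cmod (L2_inner (sing a) (expo t)) \<le> 3"
proof -
  have a': "a > -1"
    using a by simp
  have "cmod (L2_inner (sing a) (expo t)) \<le> (LINT x|MI. cmod (sing a x * cnj (expo t x)))"
    unfolding L2_inner_def by (rule integral_norm_bound)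
  also have "\<dots> = (LINT x|MI. cos (pi * x) powr a)"
    by (simp add: norm_mult cmod_sing)
  also have "\<dots> \<le> 1 + 2 / (pi * (a + 1))"
    by (rule cos_powr_integrable(2)[OF a'])
  also have "\<dots> \<le> 1 + 2"
  proof -
    have "2 * (1/2) \<le> pi * (a + 1)"
      using pi_ge_two a by (intro mult_mono) auto
    then show ?thesis
      by (simp add: pos_divide_le_eq)
  qed
  finally show ?thesis
    by simp
qed

lemma sing_orthogonal:
  assumes a: "a > -1"
  shows "L2_inner (sing a) (Fsys (- 1 - a) k) = 0"
proof (cases "k \<ge> 0")
  case True
  then obtain m where m: "k = int m"
    using zero_le_imp_eq_int by blast
  have "cosJ a (- (a/2 + real (Suc m))) = 0"
    using cosJ_zero[OF a, of m] cnj_cosJ[of a "a/2 + real (Suc m)"] by simp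
  then show ?thesis
    by (simp add: Fsys_def L2_inner_sing m algebra_simps)
next
  case False
  then have "real_of_int k = - real (Suc (nat (- k - 1)))"
    by simp
  then show ?thesis
    using False cosJ_zero[OF a, of "nat (- k - 1)"] by (simp add: Fsys_def L2_inner_sing)
qed

lemma Fsys_incomplete:
  assumes "\<xi> < -1/2"
  shows "\<not> complete_system (Fsys \<xi>)"
proof -
  \<comment> \<open>The assumption on \<open>\<xi>\<close> is exactly square integrability of
    \<open>sing a\<close>.\<close>
  define a where "a = - 1 - \<xi>"
  have a: "a > -1/2" "- 1 - a = \<xi>"
    using assms by (auto simp: a_def)
  have "0 < 2 / (pi * (2 * a + 1))"
    using a by simp
  then have "L2_norm (sing a) \<noteq> 0"
    using sing_norm[OF a(1)] by auto
  moreover have "L2_inner (sing a) (Fsys \<xi> k) = 0" for k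
    using sing_orthogonal[of a k] a by simp
  ultimately show ?thesis
    using sing_L2[OF a(1)] unfolding complete_system_def by blast
qed

section \<open>The critical shifts\<close>

text \<open>Every Fourier sum of \<open>f\<close> is exactly orthogonal to \<open>g\<close>, so the
  inner product is governed by the approximation error alone.\<close>

lemma L2_inner_disjoint_spectra:
  assumes f: "f \<in> L2" and g: "g \<in> L2" and disj: "\<And>k. fourier f k = 0 \<or> fourier g k = 0"
  shows "L2_inner f g = 0"
proof -
  have "cmod (L2_inner f g) \<le> 0 + e" if e: "e > 0" for e
  proof -
    \<comment> \<open>Adding 1 avoids division by zero when \<open>g\<close> has norm zero.\<close>
    have "e / (L2_norm g + 1) > 0"
      using e L2_norm_nonneg[of g] by simp
    then obtain F where F: "finite F"
      "L2_norm (\<lambda>x. f x - trig_sum F (fourier f) x) < e / (L2_norm g + 1)"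
      using fourier_approximation[OF f] by blast
    let ?S = "trig_sum F (fourier f)"
    have "L2_inner ?S g = (\<Sum>k\<in>F. fourier f k * cnj (fourier g k))"
      using g by (subst L2_inner_sum_left) (simp_all add: L2_inner_commute[of "expo _" g])
    also have "\<dots> = 0"
      using disj by (intro sum.neutral) auto
    finally have "L2_inner f g = L2_inner (\<lambda>x. f x - ?S x) g"
      using f g by (simp add: L2_inner_diff_left)
    then have "cmod (L2_inner f g) \<le> L2_norm (\<lambda>x. f x - ?S x) * L2_norm g"
      using L2_Cauchy_Schwarz[OF L2_diff[OF f] g, of ?S] by simp
    also have "\<dots> \<le> e / (L2_norm g + 1) * (L2_norm g + 1)"
      using F(2) e by (intro mult_mono) (auto simp: L2_norm_nonneg add_nonneg_nonneg)
    also have "\<dots> = e"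
      using L2_norm_nonneg[of g] by (simp add: add_nonneg_eq_0_iff)
    finally show ?thesis
      by simp
  qed
  then have "cmod (L2_inner f g) \<le> 0"
    by (rule field_le_epsilon)
  then show ?thesis
    by simp
qed

text \<open>If \<open>f\<close> is orthogonal to the system, then \<open>f\<close> and \<open>f * expo (-\<xi>)\<close> have disjoint
  spectra, so the integral of \<open>\<bar>f\<bar>\<^sup>2 cos (2\<pi>\<xi>x)\<close> vanishes.\<close>

lemma Fsys_complete:
  assumes \<xi>: "\<bar>\<xi>\<bar> \<le> 1/2"
  shows "complete_system (Fsys \<xi>)"
  unfolding complete_system_def
proof (intro ballI impI)
  fix f
  assume f: "f \<in> L2" and orth: "\<forall>k. L2_inner f (Fsys \<xi> k) = 0"
  let ?g = "\<lambda>x. f x * expo (-\<xi>) x"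
  have g: "?g \<in> L2"
    using f by (rule L2_mult_expo)
  have "L2_inner f ?g = 0"
  proof (rule L2_inner_disjoint_spectra[OF f g])
    fix k
    show "fourier f k = 0 \<or> fourier ?g k = 0"
      using orth[rule_format, of k] by (auto simp: L2_inner_Fsys split: if_splits)
  qed
  then have "Re (LINT x|MI. f x * cnj (?g x)) = 0"
    by (simp add: L2_inner_def)
  moreover have int: "integrable MI (\<lambda>x. f x * cnj (?g x))"
    using f g by (rule L2_inner_integrable)
  moreover have Re_eq: "Re (f x * cnj (?g x)) = (cmod (f x))\<^sup>2 * cos (2 * pi * \<xi> * x)" for x
  proof -
    have "f x * cnj (?g x) = of_real ((cmod (f x))\<^sup>2) * expo \<xi> x"
      unfolding complex_norm_square by (simp add: cnj_expo)
    then show ?thesis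
      by (simp add: expo_cis del: of_real_power)
  qed
  ultimately have "(LINT x|MI. (cmod (f x))\<^sup>2 * cos (2 * pi * \<xi> * x)) = 0"
    using integral_Re[OF int] by (simp only:)
  moreover have "integrable MI (\<lambda>x. (cmod (f x))\<^sup>2 * cos (2 * pi * \<xi> * x))"
    using integrable_Re[OF int] by (simp only: Re_eq)
  \<comment> \<open>The angle is at most \<open>pi * \<bar>x\<bar>\<close>, hence below
    \<open>pi / 2\<close> inside the interval even at the boundary shifts. This positivity lets the
    vanishing integral force \<open>f\<close> to be zero almost everywhere.\<close>
  moreover have pos: "AE x in MI. 0 < cos (2 * pi * \<xi> * x)"
    using AE_MI_interior
  proof eventually_elim
    case (elim x)
    have "\<bar>\<xi>\<bar> * \<bar>x\<bar> \<le> 1/2 * \<bar>x\<bar>"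
      using \<xi> by (intro mult_right_mono) auto
    then have "\<bar>\<xi> * x\<bar> < 1/4"
      using elim unfolding abs_mult by linarith
    then have "2 * pi * \<bar>\<xi> * x\<bar> < 2 * pi * (1/4)"
      by (intro mult_strict_left_mono) auto
    then have "\<bar>2 * pi * \<xi> * x\<bar> < pi / 2"
      by (simp add: abs_mult mult.assoc)
    then show ?case
      unfolding abs_less_iff by (intro cos_gt_zero_pi) linarith+
  qed
  ultimately have "AE x in MI. (cmod (f x))\<^sup>2 * cos (2 * pi * \<xi> * x) = 0"
    by (subst integral_nonneg_eq_0_iff_AE[symmetric]) (auto elim!: eventually_mono)
  with pos have "AE x in MI. (cmod (f x))\<^sup>2 = 0"
    by eventually_elim simp
  then have "(LINT x|MI. (cmod (f x))\<^sup>2) = 0"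
    by (rule integral_eq_zero_AE)
  then show "L2_norm f = 0"
    by (simp add: L2_norm_def)
qed

text \<open>The \<open>n\<close> coefficients with negative index at least \<open>-n\<close> are bounded by the \<open>L\<^sup>1\<close> norm; the
  others would vanish if the shift were \<open>-1/2 - e\<close> instead of \<open>-1/2\<close>, so Bessel's inequality
  applies to a function that is small compared with \<open>sing (-1/2 + e)\<close>.\<close>

lemma sing_near_critical:
  fixes n :: nat
  assumes e: "e > 0" and F: "finite F"
  shows "(\<Sum>k\<in>F. (cmod (L2_inner (sing (-1/2 + e)) (Fsys (-1/2 + real n) k)))\<^sup>2)
    \<le> 9 * real n + (pi * e)\<^sup>2 * (L2_norm (sing (-1/2 + e)))\<^sup>2"
proof -
  define a where "a = -1/2 + e"
  define f where "f = sing a"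
  \<comment> \<open>The difference between the modulation at the critical shift and the one for
    which \<open>sing a\<close> has vanishing coefficients; on \<open>I0\<close> it is at most
    \<open>pi * e\<close>.\<close>
  define \<psi> where "\<psi> x = expo (1/2) x - expo (1/2 + e) x" for x
  define g where "g x = f x * \<psi> x" for x
  let ?t = "\<lambda>k. (cmod (L2_inner f (Fsys (-1/2 + real n) k)))\<^sup>2"
  have a: "a > -1/2" "a > -1"
    using e by (auto simp: a_def)
  have f: "f \<in> L2"
    unfolding f_def using a(1) by (rule sing_L2)
  have \<psi>: "cmod (\<psi> x) \<le> pi * e" if "x \<in> I0" for x
  proof -
    have "\<psi> x = expo (1/2) x * (1 - expo e x)"
      by (simp add: \<psi>_def expo_add algebra_simps)
    then have "cmod (\<psi> x) = cmod (expo e x - 1)"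
      by (simp add: norm_mult norm_minus_commute)
    also have "\<dots> \<le> \<bar>2 * pi * e * x\<bar>"
      unfolding expo_def dist_exp_i_1 using abs_sin_x_le_abs_x[of "2 * pi * e * x / 2"] by simp
    also have "\<dots> = 2 * pi * e * \<bar>x\<bar>"
      using e by (simp add: abs_mult)
    also have "\<dots> \<le> 2 * pi * e * (1/2)"
      using that e by (intro mult_left_mono) (auto simp: I0_def)
    finally show ?thesis
      by simp
  qed
  have \<psi>m: "\<psi> \<in> borel_measurable MI"
    unfolding \<psi>_def by measurable
  have g: "g \<in> L2"
    unfolding g_def by (rule L2_mult_bounded[OF f \<psi>m \<psi>])
  have gnorm: "L2_norm g \<le> pi * e * L2_norm f"
  proof (rule L2_norm_mono[OF g f])
    show "cmod (g x) \<le> pi * e * cmod (f x)" if "x \<in> I0" for x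
      unfolding g_def norm_mult mult.commute[of "cmod (f x)"]
      by (intro mult_right_mono \<psi> that norm_ge_zero)
  qed (use e in simp)
  have pos: "?t k = 0" if "k \<ge> 0" for k
    using sing_orthogonal[OF a(2), of k] that by (simp add: f_def Fsys_def)
  have mid: "?t k \<le> 9" for k
  proof -
    have "cmod (L2_inner f (Fsys (-1/2 + real n) k)) \<le> 3"
      using L2_inner_sing_bound[of a] a by (simp add: f_def Fsys_def)
    then have "?t k \<le> 3\<^sup>2"
      by (intro power_mono) auto
    then show ?thesis
      by simp
  qed
  \<comment> \<open>Below \<open>-n\<close> the index \<open>k + n\<close> is still negative, so
    orthogonality to \<open>Fsys (-1 - a)\<close> permits subtracting a zero coefficient, which
    leaves one of \<open>g\<close>.\<close>
  have neg: "?t k = (cmod (fourier g (k + int n)))\<^sup>2" if k: "k < - int n" for k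
  proof -
    let ?j = "k + int n"
    have "L2_inner f (Fsys (-1/2 + real n) k) = L2_inner f (expo (-1/2 + of_int ?j))"
      using k by (simp add: Fsys_def algebra_simps)
    also have "\<dots> = L2_inner (\<lambda>x. f x * expo (1/2) x) (expo (of_int ?j))"
      by (subst L2_inner_expo_shift) simp
    also have "\<dots> = L2_inner (\<lambda>x. f x * expo (1/2) x) (expo (of_int ?j))
        - L2_inner (\<lambda>x. f x * expo (1/2 + e) x) (expo (of_int ?j))"
    proof -
      have "L2_inner f (Fsys (- 1 - a) ?j) = 0"
        unfolding f_def by (rule sing_orthogonal[OF a(2)])
      then show ?thesis
        using k by (simp add: L2_inner_Fsys a_def add_ac)
    qed
    also have "\<dots> = fourier g ?j"
      using f by (subst L2_inner_diff_left[symmetric])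
        (auto intro: L2_mult_expo simp: g_def[abs_def] \<psi>_def right_diff_distrib)
    finally show ?thesis
      by simp
  qed
  have "sum ?t F = sum ?t (F \<inter> {0..}) + (sum ?t (F \<inter> {- int n..<0}) + sum ?t (F \<inter> {..<- int n}))"
  proof -
    have "sum ?t F = sum ?t ((F \<inter> {0..}) \<union> ((F \<inter> {- int n..<0}) \<union> (F \<inter> {..<- int n})))"
      by (rule arg_cong[where f="sum ?t"]) auto
    also have "\<dots> = sum ?t (F \<inter> {0..}) + sum ?t ((F \<inter> {- int n..<0}) \<union> (F \<inter> {..<- int n}))"
      using F by (intro sum.union_disjoint) auto
    also have "sum ?t ((F \<inter> {- int n..<0}) \<union> (F \<inter> {..<- int n}))
        = sum ?t (F \<inter> {- int n..<0}) + sum ?t (F \<inter> {..<- int n})"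
      using F by (intro sum.union_disjoint) auto
    finally show ?thesis .
  qed
  also have "sum ?t (F \<inter> {0..}) = 0"
    using pos by (intro sum.neutral) auto
  also have "sum ?t (F \<inter> {- int n..<0}) \<le> 9 * real n"
  proof -
    have "sum ?t (F \<inter> {- int n..<0}) \<le> sum ?t {- int n..<0}"
      by (intro sum_mono2) auto
    also have "\<dots> \<le> real (card {- int n..<0}) * 9"
      using mid by (intro sum_bounded_above) auto
    finally show ?thesis
      by simp
  qed
  also have "sum ?t (F \<inter> {..<- int n}) \<le> (pi * e)\<^sup>2 * (L2_norm f)\<^sup>2"
  proof -
    have "sum ?t (F \<inter> {..<- int n}) = (\<Sum>k\<in>F \<inter> {..<- int n}. (cmod (fourier g (k + int n)))\<^sup>2)"
      using neg by (intro sum.cong) auto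
    also have "\<dots> = (\<Sum>j\<in>(\<lambda>k. k + int n) ` (F \<inter> {..<- int n}). (cmod (fourier g j))\<^sup>2)"
      by (subst sum.reindex) (auto intro: inj_onI)
    also have "\<dots> \<le> (L2_norm g)\<^sup>2"
      using F by (intro Bessel g) auto
    also have "\<dots> \<le> (pi * e * L2_norm f)\<^sup>2"
      by (intro power_mono gnorm L2_norm_nonneg)
    finally show ?thesis
      by (simp add: power_mult_distrib)
  qed
  finally show ?thesis
    by (simp add: f_def a_def)
qed

text \<open>On \<open>sing (-1/2 + e)\<close> the coefficient sum is a constant plus a small
  multiple of the squared norm. A lower frame bound would therefore bound this norm, which is
  unbounded as \<open>e\<close> tends to 0.\<close>

lemma Fsys_not_frame: "\<not> is_frame (Fsys (-1/2 + real n))"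
proof
  assume "is_frame (Fsys (-1/2 + real n))"
  then obtain A where A: "A > 0"
    and lower: "\<And>f. f \<in> L2 \<Longrightarrow> A * (L2_norm f)\<^sup>2 \<le> (\<Sum>\<^sub>\<infinity>k. (cmod (L2_inner f (Fsys (-1/2 + real n) k)))\<^sup>2)"
    unfolding is_frame_def by blast
  \<comment> \<open>The 1 gives \<open>\<eta>\<^sup>2 \<le> \<eta> \<le> A / 2\<close>, so half of
    the frame bound absorbs the small term. The other entry makes \<open>A / (2 * \<eta>)\<close> at
    least \<open>9 * real n + 1\<close>, which exceeds the constant.\<close>
  define \<eta> where "\<eta> = min 1 (A / (2 * (9 * real n + 1)))"
  define e where "e = \<eta> / pi"
  define f where "f = sing (-1/2 + e)"
  have \<eta>: "0 < \<eta>" "\<eta> \<le> 1" "\<eta> \<le> A / (2 * (9 * real n + 1))"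
    using A by (auto simp: \<eta>_def)
  have e: "e > 0" "pi * e = \<eta>"
    using \<eta> by (auto simp: e_def)
  have f: "f \<in> L2"
    unfolding f_def using e by (intro sing_L2) simp
  have "A / (2 * (9 * real n + 1)) \<le> A / 2"
    using A by (intro divide_left_mono) auto
  moreover have "\<eta>\<^sup>2 \<le> \<eta>"
    using \<eta> mult_left_le_one_le[of \<eta> \<eta>] by (simp add: power2_eq_square)
  ultimately have "\<eta>\<^sup>2 \<le> A / 2"
    using \<eta>(3) by linarith
  have norm_f: "1 / \<eta> \<le> (L2_norm f)\<^sup>2"
    using sing_norm[of "-1/2 + e"] e by (simp add: f_def distrib_left field_simps)
  have "A * (L2_norm f)\<^sup>2 \<le> (\<Sum>\<^sub>\<infinity>k. (cmod (L2_inner f (Fsys (-1/2 + real n) k)))\<^sup>2)"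
    by (rule lower[OF f])
  also have "\<dots> \<le> 9 * real n + \<eta>\<^sup>2 * (L2_norm f)\<^sup>2"
    using sing_near_critical[OF e(1), of _ n] e(2)
    by (intro infsum_le_finite_sums Fsys_square_summable f) (auto simp: f_def)
  also have "\<dots> \<le> 9 * real n + A / 2 * (L2_norm f)\<^sup>2"
    using \<open>\<eta>\<^sup>2 \<le> A / 2\<close> by (intro add_left_mono mult_right_mono) auto
  finally have "A / 2 * (L2_norm f)\<^sup>2 \<le> 9 * real n"
    by (simp add: field_simps)
  moreover have "A / 2 * (1 / \<eta>) \<le> A / 2 * (L2_norm f)\<^sup>2"
    using A norm_f by (intro mult_left_mono) auto
  moreover have "9 * real n + 1 \<le> A / 2 * (1 / \<eta>)"
  proof -
    have "\<eta> * (2 * (9 * real n + 1)) \<le> A"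
      using \<eta>(3) by (subst (asm) pos_le_divide_eq) auto
    then show ?thesis
      using \<eta>(1) by (simp add: field_simps)
  qed
  ultimately show False
    by linarith
qed

section \<open>Subsystems and the classification\<close>

text \<open>Its range is what remains of the index set after deleting \<open>-n, ..., -1\<close>,
  enumerated so that the subsystem is again of the form \<open>Fsys\<close>.\<close>

definition skip :: "nat \<Rightarrow> int \<Rightarrow> int" where
  "skip n k = (if k \<ge> 0 then k else k - int n)"

lemma inj_skip: "inj (skip n)"
  by (auto simp: inj_def skip_def split: if_splits)

lemma Fsys_skip: "Fsys \<xi> (skip n k) = Fsys (\<xi> - real n) k"
  by (simp add: Fsys_def skip_def algebra_simps)

lemma complete_system_skip:
  assumes "complete_system (Fsys (\<xi> - real n))"
  shows "complete_system (Fsys \<xi>)"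
  using assms unfolding complete_system_def Fsys_skip[symmetric] by blast

text \<open>Extra elements only increase the coefficient sum, so the lower bound survives; the upper
  one always holds by Bessel.\<close>

lemma is_frame_skip:
  assumes "is_frame (Fsys (\<xi> - real n))"
  shows "is_frame (Fsys \<xi>)"
proof -
  obtain A where A: "A > 0"
    and lower: "\<And>f. f \<in> L2 \<Longrightarrow> A * (L2_norm f)\<^sup>2 \<le> (\<Sum>\<^sub>\<infinity>k. (cmod (L2_inner f (Fsys (\<xi> - real n) k)))\<^sup>2)"
    using assms unfolding is_frame_def by blast
  show ?thesis
  proof (rule Fsys_frameI[OF A])
    fix f
    assume f: "f \<in> L2"
    let ?t = "\<lambda>k. (cmod (L2_inner f (Fsys \<xi> k)))\<^sup>2"
    have sum: "?t summable_on UNIV"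
      by (rule Fsys_square_summable[OF f])
    have "(\<Sum>\<^sub>\<infinity>k. (cmod (L2_inner f (Fsys (\<xi> - real n) k)))\<^sup>2) = infsum ?t (range (skip n))"
      by (simp add: infsum_reindex[OF inj_skip] o_def Fsys_skip)
    also have "\<dots> \<le> infsum ?t UNIV"
      by (intro infsum_mono2 sum summable_on_subset_banach[OF sum]) auto
    finally show "A * (L2_norm f)\<^sup>2 \<le> infsum ?t UNIV"
      using lower[OF f] by simp
  qed
qed

lemma has_expansion_skip:
  assumes "has_expansion (Fsys (\<xi> - real n)) f \<alpha>"
  shows "has_expansion (Fsys \<xi>) f (\<lambda>j. if j \<in> range (skip n) then \<alpha> (inv (skip n) j) else 0)"
    (is "has_expansion _ _ ?\<beta>")
  unfolding has_expansion_iff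
proof (intro allI impI)
  fix e :: real
  assume "e > 0"
  from assms[unfolded has_expansion_iff, rule_format, OF this] obtain F where F: "finite F"
    and close: "\<And>G. finite G \<Longrightarrow> F \<subseteq> G \<Longrightarrow> L2_norm (\<lambda>x. f x - lincomb (Fsys (\<xi> - real n)) G \<alpha> x) < e"
    by blast
  show "\<exists>F. finite F \<and> (\<forall>G. finite G \<longrightarrow> F \<subseteq> G \<longrightarrow> L2_norm (\<lambda>x. f x - lincomb (Fsys \<xi>) G ?\<beta> x) < e)"
  proof (intro exI[of _ "skip n ` F"] conjI allI impI)
    show "finite (skip n ` F)"
      using F by simp
    fix G
    assume G: "finite G" "skip n ` F \<subseteq> G"
    \<comment> \<open>\<open>G\<close> may contain deleted indices, but their coefficients are 0, so
      only the preimage contributes.\<close>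
    let ?G = "skip n -` G"
    have "lincomb (Fsys \<xi>) G ?\<beta> x = lincomb (Fsys (\<xi> - real n)) ?G \<alpha> x" for x
    proof -
      have "lincomb (Fsys \<xi>) G ?\<beta> x = (\<Sum>j\<in>skip n ` ?G. ?\<beta> j * Fsys \<xi> j x)"
        using G(1) by (intro sum.mono_neutral_right) auto
      also have "\<dots> = (\<Sum>k\<in>?G. ?\<beta> (skip n k) * Fsys \<xi> (skip n k) x)"
        by (subst sum.reindex) (auto intro: inj_on_subset[OF inj_skip])
      also have "\<dots> = lincomb (Fsys (\<xi> - real n)) ?G \<alpha> x"
        by (simp add: Fsys_skip inv_f_f[OF inj_skip])
      finally show ?thesis .
    qed
    then show "L2_norm (\<lambda>x. f x - lincomb (Fsys \<xi>) G ?\<beta> x) < e"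
      using close[of ?G] G finite_vimageI[OF G(1) inj_skip] by auto
  qed
qed

text \<open>The deleted element \<open>Fsys \<xi> (-1)\<close> has two expansions: the trivial one,
  and the one over the remaining basis, whose coefficient at -1 is 0.\<close>

lemma not_riesz_basis_skip:
  assumes riesz: "riesz_basis (Fsys (\<xi> - real n))" and n: "n \<ge> 1"
  shows "\<not> riesz_basis (Fsys \<xi>)"
proof
  assume "riesz_basis (Fsys \<xi>)"
  then have unique: "\<exists>!\<alpha>. has_expansion (Fsys \<xi>) (Fsys \<xi> (-1)) \<alpha>"
    by (simp add: riesz_basis_def)
  obtain \<alpha> where "has_expansion (Fsys (\<xi> - real n)) (Fsys \<xi> (-1)) \<alpha>"
    using riesz unfolding riesz_basis_def by (meson Fsys_L2)
  then have 1: "has_expansion (Fsys \<xi>) (Fsys \<xi> (-1)) (\<lambda>j. if j \<in> range (skip n) then \<alpha> (inv (skip n) j) else 0)"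
    by (rule has_expansion_skip)
  have 2: "has_expansion (Fsys \<xi>) (Fsys \<xi> (-1)) (\<lambda>j. if j = -1 then 1 else 0)"
    unfolding has_expansion_iff
  proof (intro allI impI exI[of _ "{-1}"] conjI)
    fix e :: real and G :: "int set"
    assume "e > 0" "finite G" "{-1} \<subseteq> G"
    moreover from this have "lincomb (Fsys \<xi>) G (\<lambda>j. if j = -1 then 1 else 0) x = Fsys \<xi> (-1) x" for x
      by (subst sum.mono_neutral_right[of G "{-1}"]) auto
    ultimately show "L2_norm (\<lambda>x. Fsys \<xi> (-1) x - lincomb (Fsys \<xi>) G (\<lambda>j. if j = -1 then 1 else 0) x) < e"
      by (simp add: L2_norm_def)
  qed simp
  have "-1 \<notin> range (skip n)"
    using n by (auto simp: skip_def)
  moreover have "(\<lambda>j. if j \<in> range (skip n) then \<alpha> (inv (skip n) j) else 0) = (\<lambda>j. if j = -1 then 1 else 0)"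
    using unique 1 2 by blast
  ultimately show False
    by (auto dest: fun_cong[of _ _ "-1"])
qed

theorem mainTheorem8:
  fixes \<xi> :: real
  shows "(\<xi> < -1/2 \<longrightarrow> \<not> complete_system (Fsys \<xi>))
       \<and> (-1/2 < \<xi> \<and> \<xi> < 1/2 \<longrightarrow> riesz_basis (Fsys \<xi>))
       \<and> (\<forall>n::int. n \<ge> 1 \<and> -1/2 + real_of_int n < \<xi> \<and> \<xi> < 1/2 + real_of_int n
            \<longrightarrow> is_frame (Fsys \<xi>) \<and> \<not> riesz_basis (Fsys \<xi>))
       \<and> (\<forall>n::int. n \<ge> 0 \<and> \<xi> = -1/2 + real_of_int n
            \<longrightarrow> complete_system (Fsys \<xi>) \<and> \<not> riesz_basis (Fsys \<xi>) \<and> \<not> is_frame (Fsys \<xi>))"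
proof (intro conjI[where P="_ \<longrightarrow> _"] conjI[where P="All _"] allI impI)
  show "\<not> complete_system (Fsys \<xi>)" if "\<xi> < -1/2"
    using that by (rule Fsys_incomplete)
  show "riesz_basis (Fsys \<xi>)" if "-1/2 < \<xi> \<and> \<xi> < 1/2"
    using that by (intro Fsys_riesz_basis) auto
  show "is_frame (Fsys \<xi>) \<and> \<not> riesz_basis (Fsys \<xi>)"
    if n: "n \<ge> 1 \<and> -1/2 + real_of_int n < \<xi> \<and> \<xi> < 1/2 + real_of_int n" for n :: int
  proof -
    obtain m where m: "n = int m"
      using n zero_le_imp_eq_int[of n] by auto
    have "-1/2 + real m < \<xi>" "\<xi> < 1/2 + real m"
      using n m by auto
    then have "\<bar>\<xi> - real m\<bar> < 1/2"
      by linarith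
    then have "riesz_basis (Fsys (\<xi> - real m))"
      by (rule Fsys_riesz_basis)
    then show ?thesis
      using is_frame_skip not_riesz_basis_skip[of \<xi> m] n m by (auto simp: riesz_basis_def)
  qed
  show "complete_system (Fsys \<xi>) \<and> \<not> riesz_basis (Fsys \<xi>) \<and> \<not> is_frame (Fsys \<xi>)"
    if n: "n \<ge> 0 \<and> \<xi> = -1/2 + real_of_int n" for n :: int
  proof -
    obtain m where m: "n = int m"
      using n zero_le_imp_eq_int[of n] by auto
    \<comment> \<open>The reduced shift is exactly -1/2, a boundary value that
      \<open>Fsys_complete\<close> still covers.\<close>
    have "complete_system (Fsys (\<xi> - real m))"
      using n m by (intro Fsys_complete) auto
    moreover have "\<not> is_frame (Fsys \<xi>)"
      using Fsys_not_frame[of m] n m by simp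
    ultimately show ?thesis
      using complete_system_skip by (auto simp: riesz_basis_def)
  qed
qed

end
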